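(* Let $m,n\geq 3$, $k\geq 2$ be integers and $p=(m-1)(n-1)+k$. The set $\mathrm{trank}(m,n,p)$ of typical ranks of $\mathbb{R}^{m\times n\times p}$ is given by $$\mathrm{trank}(m,n,p)=\begin{cases}\{p,p+1\}, & 2\leq k\leq m+n-1-(m\# n),\\ \{p\}, & \max\{2,(m+n)-(m\# n)\}\leq k\leq m+n-2,\\ \{mn\}, & k\geq m+n-1.\end{cases}$$
   Context: $\mathbb{R}^{m\times n\times p}$ is the space of real $m\times n\times p$ tensors (3-way arrays, i.e. elements of $\mathbb{R}^m\otimes\mathbb{R}^n\otimes\mathbb{R}^p$) with the Euclidean topology. The rank of a tensor $T$ is the minimal $r$ such that $T$ is a sum of $r$ tensors of the form $\mathbf{a}\otimes\mathbf{b}\otimes\mathbf{c}$. An integer $r$ is a typical rank of $\mathbb{R}^{m\times n\times p}$ if the set of tensors of rank $r$ contains a nonempty open subset of $\mathbb{R}^{m\times n\times p}$. A bilinear map $f\colon\mathbb{R}^m\times\mathbb{R}^n\to\mathbb{R}^l$ is nonsingular if $f(\mathbf{x},\mathbf{y})=0$ implies $\mathbf{x}=0$ or $\mathbf{y}=0$. For positive integers $m,n$, $m\# n$ is the minimal integer $l$ such that there exists a nonsingular bilinear map $\mathbb{R}^m\times\mathbb{R}^n\to\mathbb{R}^l$. *)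

theory Defs
  imports "HOL-Analysis.Analysis"
begin

text \<open>
  The space of real m x n x p tensors is the type \<open>real^'p^'n^'m\<close> with \<open>m = CARD('m)\<close>,
  \<open>n = CARD('n)\<close>, \<open>p = CARD('p)\<close>; the (i,j,l) entry of \<open>T\<close> is \<open>T $ i $ j $ l\<close>.
\<close>

definition outer3 :: "real^'m \<Rightarrow> real^'n \<Rightarrow> real^'p \<Rightarrow> real^'p^'n^'m" where
  "outer3 a b c = (\<chi> i j l. a $ i * b $ j * c $ l)"

definition tensor_rank :: "real^'p^'n^'m \<Rightarrow> nat" where
  "tensor_rank T =
    (LEAST r. \<exists>(a :: nat \<Rightarrow> real^'m) (b :: nat \<Rightarrow> real^'n) (c :: nat \<Rightarrow> real^'p).
       T = (\<Sum>s<r. outer3 (a s) (b s) (c s)))"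

definition trank :: "'m::finite itself \<Rightarrow> 'n::finite itself \<Rightarrow> 'p::finite itself \<Rightarrow> nat set" where
  "trank tm tn tp =
    {r. \<exists>U :: (real^'p^'n^'m) set. open U \<and> U \<noteq> {} \<and> U \<subseteq> {T. tensor_rank T = r}}"

text \<open>
  The target dimension \<open>l\<close> has to be quantified over, so it cannot be a type: a vector of the target
  l-space is a function \<open>nat \<Rightarrow> real\<close> of which only the coordinates \<open>i < l\<close> matter, and a map into
  it is bilinear iff each of these coordinates is.
\<close>

definition nonsingular_bilinear :: "nat \<Rightarrow> (real^'m \<Rightarrow> real^'n \<Rightarrow> nat \<Rightarrow> real) \<Rightarrow> bool" where
  "nonsingular_bilinear l f \<longleftrightarrow>
    (\<forall>i<l. bilinear (\<lambda>x y. f x y i)) \<and>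
    (\<forall>x y. (\<forall>i<l. f x y i = 0) \<longrightarrow> x = 0 \<or> y = 0)"

text \<open>The number \<open>m # n\<close>.\<close>

definition hash_number :: "'m::finite itself \<Rightarrow> 'n::finite itself \<Rightarrow> nat" where
  "hash_number tm tn =
    (LEAST l. \<exists>f :: real^'m \<Rightarrow> real^'n \<Rightarrow> nat \<Rightarrow> real. nonsingular_bilinear l f)"

end

theory Submission
  imports Defs "HOL-Computational_Algebra.Polynomial" "HOL-Library.Cardinality"
begin

text \<open>
  The rank of \<open>T\<close> is the least number of rank-one matrices whose span contains the span \<open>V\<close> of its
  \<open>p\<close> slices, so for generic \<open>T\<close> with \<open>p \<le> m n\<close> it is at least \<open>dim V = p\<close>. The orthogonal
  complement of \<open>V\<close> is a bilinear map to \<open>\<real>\<^sup>u\<close>, \<open>u = m n - p\<close>, whose zeros are the rank-one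
  matrices in \<open>V\<close>. If it is nonsingular, then \<open>V\<close> and all its neighbours contain no rank-one matrix,
  and the rank exceeds \<open>p\<close>.

  Conversely, suppose that \<open>V\<close> contains a rank-one matrix, say \<open>e \<otimes> e'\<close> for basis vectors \<open>e\<close>, \<open>e'\<close>,
  and \<open>p \<ge> (m - 1) (n - 1) + 2\<close>. After a perturbation \<open>V\<close> is a graph over suitable \<open>p\<close> entries of the
  matrix, and the rank-one matrices in \<open>V\<close> near \<open>e \<otimes> e'\<close> contain curves in a parameter \<open>t\<close> whose
  Taylor coefficients are polynomial in \<open>V\<close>. That finitely many of these coefficients span \<open>V\<close> is
  therefore a Zariski open condition, and it holds for a \<open>V\<close> containing the monomial curve
  \<open>x\<^sub>i = t ^ \<alpha> i\<close>, \<open>y\<^sub>j = t ^ \<beta> j\<close> with pairwise distinct sums \<open>\<alpha> i + \<beta> j\<close>. Hence a small perturbation of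
  \<open>V\<close> is spanned by rank-one matrices that are regular points of the intersection with the cone of
  rank-one matrices, and by the open mapping theorem all tensors near the perturbed one have rank at
  most \<open>p\<close>. Adding a rank-one slice to an arbitrary \<open>T\<close> shows that rank at most \<open>p + 1\<close> is generic.
\<close>

section \<open>Rank and generic tensors\<close>

lemma tensor_rank_le_sum:
  fixes T :: "real^'p^'n^'m"
  assumes "finite S" and T: "T = (\<Sum>s\<in>S. outer3 (a s) (b s) (c s))"
  shows "tensor_rank T \<le> card S"
proof -
  obtain h where h: "bij_betw h {..<card S} S"
    using \<open>finite S\<close> ex_bij_betw_nat_finite lessThan_atLeast0 by metis
  have "T = (\<Sum>s<card S. outer3 (a (h s)) (b (h s)) (c (h s)))"
    unfolding T by (rule sum.reindex_bij_betw[OF h, symmetric])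
  then show ?thesis unfolding tensor_rank_def
    by (intro Least_le exI[of _ "\<lambda>s. a (h s)"] exI[of _ "\<lambda>s. b (h s)"] exI[of _ "\<lambda>s. c (h s)"])
qed

lemma tensor_eq_sum_outer3:
  fixes T :: "real^'p^'n^'m"
  shows "T = (\<Sum>(i,j)\<in>UNIV. outer3 (axis i 1) (axis j 1) (T $ i $ j))"
proof -
  have "T $ i $ j $ l = (\<Sum>(i',j')\<in>UNIV. outer3 (axis i' 1) (axis j' 1) (T $ i' $ j')) $ i $ j $ l" for i j l
  proof -
    have "(\<Sum>(i',j')\<in>UNIV. outer3 (axis i' 1) (axis j' 1) (T $ i' $ j')) $ i $ j $ l =
      (\<Sum>z\<in>UNIV. if z = (i,j) then T $ i $ j $ l else 0)"
      unfolding sum_component by (rule sum.cong) (auto simp: outer3_def axis_def split: if_splits)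
    then show ?thesis by simp
  qed
  then show ?thesis by (simp add: vec_eq_iff)
qed

text \<open>Expanding T along its m n mode-3 fibres shows that the set under \<open>LEAST\<close> is
  nonempty, so the minimum is attained.\<close>

lemma tensor_rank_decomp:
  fixes T :: "real^'p^'n^'m"
  obtains a :: "nat \<Rightarrow> real^'m" and b :: "nat \<Rightarrow> real^'n" and c :: "nat \<Rightarrow> real^'p"
    where "T = (\<Sum>s<tensor_rank T. outer3 (a s) (b s) (c s))"
proof -
  let ?P = "\<lambda>r. \<exists>(a :: nat \<Rightarrow> real^'m) (b :: nat \<Rightarrow> real^'n) (c :: nat \<Rightarrow> real^'p).
       T = (\<Sum>s<r. outer3 (a s) (b s) (c s))"
  obtain h where h: "bij_betw h {..<card (UNIV::('m\<times>'n) set)} (UNIV::('m\<times>'n) set)"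
    using ex_bij_betw_nat_finite lessThan_atLeast0 finite_class.finite_UNIV by metis
  have "T = (\<Sum>s<card (UNIV::('m\<times>'n) set). case h s of (i,j) \<Rightarrow> outer3 (axis i 1) (axis j 1) (T $ i $ j))"
    by (subst tensor_eq_sum_outer3) (rule sum.reindex_bij_betw[OF h, symmetric])
  then have "?P (card (UNIV::('m\<times>'n) set))"
    by (intro exI[of _ "\<lambda>s. axis (fst (h s)) 1"] exI[of _ "\<lambda>s. axis (snd (h s)) 1"]
          exI[of _ "\<lambda>s. T $ fst (h s) $ snd (h s)"]) (simp add: case_prod_beta)
  then have "?P (tensor_rank T)" unfolding tensor_rank_def by (rule LeastI)
  then show ?thesis using that by blast
qed

lemma tensor_rank_le_mn:
  fixes T :: "real^'p^'n^'m"
  shows "tensor_rank T \<le> CARD('m) * CARD('n)"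
proof -
  have "tensor_rank T \<le> card (UNIV :: ('m\<times>'n) set)"
    by (rule tensor_rank_le_sum[where a = "\<lambda>z. axis (fst z) 1" and b = "\<lambda>z. axis (snd z) 1"
          and c = "\<lambda>z. T $ fst z $ snd z"])
       (use tensor_eq_sum_outer3[of T] in \<open>simp_all add: case_prod_beta\<close>)
  then show ?thesis by simp
qed

lemma tensor_rank_linear_image_le:
  fixes g :: "real^'p^'n^'m \<Rightarrow> real^'p1^'n1^'m1"
  assumes "linear g" and g: "\<And>a b c. \<exists>a' b' c'. g (outer3 a b c) = outer3 a' b' c'"
  shows "tensor_rank (g T) \<le> tensor_rank T"
proof -
  obtain a b c where T: "T = (\<Sum>s<tensor_rank T. outer3 (a s) (b s) (c s))"
    by (rule tensor_rank_decomp)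
  have "\<forall>s. \<exists>z. g (outer3 (a s) (b s) (c s)) = outer3 (fst z) (fst (snd z)) (snd (snd z))"
    using g by (metis fst_conv snd_conv)
  then obtain z where "\<forall>s. g (outer3 (a s) (b s) (c s)) = outer3 (fst (z s)) (fst (snd (z s))) (snd (snd (z s)))"
    by (rule choice[THEN exE])
  then have "g T = (\<Sum>s<tensor_rank T. outer3 (fst (z s)) (fst (snd (z s))) (snd (snd (z s))))"
    by (subst T) (simp add: linear_sum[OF \<open>linear g\<close>])
  from tensor_rank_le_sum[OF _ this] show ?thesis by simp
qed

text \<open>Surjective linear maps are open, and a map that respects rank-one tensors cannot raise
  the rank. Source and target formats may differ, so this covers coordinate changes as well as the
  deletion of a slice.\<close>

lemma closure_interior_rank_image:
  fixes g :: "real^'p^'n^'m \<Rightarrow> real^'p1^'n1^'m1"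
  assumes "linear g" and "surj g" and g: "\<And>a b c. \<exists>a' b' c'. g (outer3 a b c) = outer3 a' b' c'"
    and T: "T \<in> closure (interior {T. tensor_rank T \<le> r})"
  shows "g T \<in> closure (interior {T. tensor_rank T \<le> r})"
proof -
  let ?S = "interior {T :: real^'p^'n^'m. tensor_rank T \<le> r}"
  have "open (g ` ?S)" using assms by (intro open_surjective_linear_image) auto
  moreover have "g ` ?S \<subseteq> {T. tensor_rank T \<le> r}"
  proof safe
    fix T assume "T \<in> ?S"
    then have "tensor_rank T \<le> r" using interior_subset by blast
    then show "tensor_rank (g T) \<le> r"
      using tensor_rank_linear_image_le[OF assms(1) g, of T] by simp
  qed
  ultimately have "g ` ?S \<subseteq> interior {T. tensor_rank T \<le> r}" by (rule interior_maximal[rotated])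
  moreover have "g T \<in> closure (g ` ?S)"
    using closure_linear_image_subset[OF \<open>linear g\<close>] T by blast
  ultimately show ?thesis using closure_mono by blast
qed

section \<open>Contraction along the third factor\<close>

definition outer2 :: "real^'m \<Rightarrow> real^'n \<Rightarrow> real^'n^'m" where
  "outer2 a b = (\<chi> i j. a $ i * b $ j)"

text \<open>The slices of \<open>T\<close> in the third direction span the image of \<open>contract T\<close>.\<close>

definition contract :: "real^'p^'n^'m \<Rightarrow> real^'p \<Rightarrow> real^'n^'m" where
  "contract T v = (\<chi> i j. \<Sum>l\<in>UNIV. T $ i $ j $ l * v $ l)"

lemma linear_contract: "linear (contract T)"
  by (rule linearI)
     (simp_all add: contract_def vec_eq_iff algebra_simps sum.distrib sum_distrib_left)

lemma contract_sum_outer3: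
  "contract (\<Sum>s\<in>S. outer3 (a s) (b s) (c s)) v = (\<Sum>s\<in>S. inner (c s) v *\<^sub>R outer2 (a s) (b s))"
  unfolding contract_def outer2_def outer3_def vec_eq_iff
  by (auto simp: inner_vec_def sum_distrib_right sum_distrib_left algebra_simps intro: sum.swap)

text \<open>Applied to factors of a decomposition, this gives a vector that kills r of its terms;
  all lower bounds on the rank rest on it.\<close>

lemma exists_orthogonal_to_few:
  fixes c :: "nat \<Rightarrow> 'a::euclidean_space"
  assumes "r < DIM('a)"
  obtains v where "v \<noteq> 0" "\<And>s. s < r \<Longrightarrow> inner (c s) v = 0"
proof -
  have "dim (c ` {..<r}) \<le> card (c ` {..<r})" by (rule dim_le_card') simp
  also have "\<dots> \<le> r" using card_image_le[of "{..<r}" c] by simp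
  finally have "dim (c ` {..<r}) < DIM('a)" using assms by simp
  then obtain v where "v \<noteq> 0" "\<And>y. y \<in> span (c ` {..<r}) \<Longrightarrow> orthogonal v y"
    using orthogonal_to_subspace_exists by blast
  moreover have "c s \<in> span (c ` {..<r})" if "s < r" for s
    using that by (intro span_base) simp
  ultimately show ?thesis
    by (intro that[of v]) (auto simp: orthogonal_def inner_commute[of _ v])
qed

section \<open>Polynomial functions on lines and density\<close>

text \<open>Along the line, \<open>\<phi>\<close> is a univariate polynomial that is nonzero at s =
  1.\<close>

lemma finite_zeros_on_line:
  fixes \<phi> :: "'a::real_normed_vector \<Rightarrow> real"
  assumes "real_polynomial_function \<phi>" and "\<phi> B \<noteq> 0"
  shows "finite {s. \<phi> (A + s *\<^sub>R (B - A)) = 0}"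
proof -
  have line: "polynomial_function (\<lambda>s. A + s *\<^sub>R (B - A))"
    by (intro polynomial_function_add polynomial_function_const polynomial_function_mult
        polynomial_function_id)
  have "real_polynomial_function (\<phi> \<circ> (\<lambda>s. A + s *\<^sub>R (B - A)))"
    by (rule real_polynomial_function_compose[OF line assms(1)])
  then obtain c n where c: "(\<phi> \<circ> (\<lambda>s. A + s *\<^sub>R (B - A))) = (\<lambda>x. \<Sum>i\<le>n. c i * x ^ i)"
    using real_polynomial_function_imp_sum by blast
  then have eq: "\<phi> (A + s *\<^sub>R (B - A)) = (\<Sum>i\<le>n. c i * s ^ i)" for s
    by (metis comp_apply)
  have "\<exists>i\<le>n. c i \<noteq> 0"
    using eq[of 1] assms(2) by (auto intro: ccontr)
  then show ?thesis unfolding eq by (auto intro: Poly_Roots.polyfun_rootbound_finite)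
qed

text \<open>Passes a property that holds off the zeros of a polynomial on a line to the closure at s
  = 0, whether or not the polynomial vanishes there.\<close>

lemma closure_from_cofinite_line:
  fixes A B :: "'a::real_normed_vector"
  assumes "finite {s. A + s *\<^sub>R B \<notin> X}"
  shows "A \<in> closure X"
proof -
  have "\<forall>\<^sub>F s in at 0. A + s *\<^sub>R B \<in> X"
    using assms islimpt_finite[of "{s. A + s *\<^sub>R B \<notin> X}" "0::real"]
    by (simp add: islimpt_iff_eventually)
  moreover have "((\<lambda>s. A + s *\<^sub>R B) \<longlongrightarrow> A + 0 *\<^sub>R B) (at 0)" by (intro tendsto_intros)
  ultimately show ?thesis
    using Lim_in_closed_set[OF closed_closure, of "\<lambda>s. A + s *\<^sub>R B" X "at 0" A]
      eventually_mono[of "\<lambda>s. A + s *\<^sub>R B \<in> X" "at 0" "\<lambda>s. A + s *\<^sub>R B \<in> closure X"]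
      closure_subset[of X] by auto
qed

lemma nonzero_set_open_dense:
  fixes \<phi> :: "'a::euclidean_space \<Rightarrow> real"
  assumes "real_polynomial_function \<phi>" and "\<phi> B \<noteq> 0"
  shows "open {x. \<phi> x \<noteq> 0}" and "closure {x. \<phi> x \<noteq> 0} = UNIV"
proof -
  have "continuous_on UNIV \<phi>"
    using assms(1) by (metis continuous_on_polymonial_function real_polynomial_function_eq)
  then show "open {x. \<phi> x \<noteq> 0}" by (intro open_Collect_neq) auto
  show "closure {x. \<phi> x \<noteq> 0} = UNIV"
    using closure_from_cofinite_line[where B = "B - x" and A = x and X = "{x. \<phi> x \<noteq> 0}" for x]
      finite_zeros_on_line[OF assms] by auto
qed

lemma det_nonzero_iff_ker:
  fixes A :: "real^'q^'q"
  shows "det A \<noteq> 0 \<longleftrightarrow> (\<forall>x. A *v x = 0 \<longrightarrow> x = 0)"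
  by (simp only: invertible_det_nz[symmetric] invertible_left_inverse matrix_left_invertible_ker)

lemma real_polynomial_function_det:
  fixes M :: "'a::real_normed_vector \<Rightarrow> real^'q^'q"
  assumes "\<And>i j. real_polynomial_function (\<lambda>x. M x $ i $ j)"
  shows "real_polynomial_function (\<lambda>x. det (M x))"
  unfolding det_def
  by (intro real_polynomial_function_sum real_polynomial_function_prod real_polynomial_function.intros(4)
      real_polynomial_function.intros(2) assms) (auto simp: finite_permutations)

lemma real_polynomial_function_entry:
  "real_polynomial_function (\<lambda>T::real^'p^'n^'m. T $ i $ j $ l)"
  by (intro real_polynomial_function.intros(1) linear_conv_bounded_linear[THEN iffD1] linearI) auto

section \<open>Interior points of the set of tensors of bounded rank\<close>

lemma has_derivative_vec_nthI:
  fixes f :: "'a::real_normed_vector \<Rightarrow> ('b::euclidean_space)^'n"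
  assumes "\<And>i. ((\<lambda>x. f x $ i) has_derivative (\<lambda>h. f' h $ i)) (at x)"
  shows "(f has_derivative f') (at x)"
  unfolding has_derivative_componentwise_within[of f f' x UNIV]
  by (auto simp: Basis_vec_def inner_axis intro!: has_derivative_inner_left assms)

lemma has_derivative_entry3:
  fixes f :: "'a::real_normed_vector \<Rightarrow> real^'p^'n^'m"
  assumes "\<And>i j l. ((\<lambda>x. f x $ i $ j $ l) has_derivative (\<lambda>h. f' h $ i $ j $ l)) (at x)"
  shows "(f has_derivative f') (at x)"
  by (intro has_derivative_vec_nthI assms)

lemma bounded_linear_coords:
  shows "bounded_linear (\<lambda>z::(real^'m^'q) \<times> (real^'n^'q) \<times> (real^'q^'q). fst z $ s $ i)"
    and "bounded_linear (\<lambda>z::(real^'m^'q) \<times> (real^'n^'q) \<times> (real^'q^'q). fst (snd z) $ s $ j)"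
    and "bounded_linear (\<lambda>z::(real^'m^'q) \<times> (real^'n^'q) \<times> (real^'q^'q). snd (snd z) $ s $ l)"
  by (auto intro!: linear_conv_bounded_linear[THEN iffD1] linearI)

text \<open>The tangent condition says that each \<open>a s \<otimes> b s\<close> is a regular point of the intersection of the
  cone of rank-one matrices with the span of the slices.\<close>

lemma interior_rank_le_if_tangent:
  fixes T :: "real^'q^'n^'m" and a :: "'q \<Rightarrow> real^'m" and b :: "'q \<Rightarrow> real^'n"
  assumes T: "\<And>i j s. T $ i $ j $ s = a s $ i * b s $ j"
    and tangent: "\<And>s M. \<exists>\<delta>a \<delta>b v. M = outer2 \<delta>a (b s) + outer2 (a s) \<delta>b + contract T v"
  shows "T \<in> interior {T. tensor_rank T \<le> CARD('q)}"
proof -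
  \<comment> \<open>Parametrises the sums of q rank-one tensors. At \<open>z0\<close> the third
    factors are the unit vectors, so term s is slice s of T.\<close>
  define \<Psi> :: "(real^'m^'q) \<times> (real^'n^'q) \<times> (real^'q^'q) \<Rightarrow> real^'q^'n^'m"
    where "\<Psi> z = (\<chi> i j l. \<Sum>s\<in>UNIV. fst z $ s $ i * fst (snd z) $ s $ j * snd (snd z) $ s $ l)" for z
  define z0 :: "(real^'m^'q) \<times> (real^'n^'q) \<times> (real^'q^'q)"
    where "z0 = ((\<chi> s. a s), (\<chi> s. b s), mat 1)"
  \<comment> \<open>The derivative at \<open>z0\<close>: slice l of \<open>D h\<close> is a tangent
    vector of the rank-one cone at \<open>outer2 (a l) (b l)\<close> plus a combination of slices of
    T.\<close>
  define D :: "(real^'m^'q) \<times> (real^'n^'q) \<times> (real^'q^'q) \<Rightarrow> real^'q^'n^'m"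
    where "D h = (\<chi> i j l. (\<Sum>s\<in>UNIV. a s $ i * b s $ j * snd (snd h) $ s $ l)
         + fst h $ l $ i * b l $ j + a l $ i * fst (snd h) $ l $ j)" for h
  have der: "(\<Psi> has_derivative D) (at z0)"
  proof (rule has_derivative_entry3)
    fix i j l
    have "((\<lambda>z. \<Sum>s\<in>UNIV. fst z $ s $ i * fst (snd z) $ s $ j * snd (snd z) $ s $ l)
      has_derivative (\<lambda>h. \<Sum>s\<in>UNIV. fst z0 $ s $ i * fst (snd z0) $ s $ j * snd (snd h) $ s $ l
         + (fst z0 $ s $ i * fst (snd h) $ s $ j + fst h $ s $ i * fst (snd z0) $ s $ j) * snd (snd z0) $ s $ l)) (at z0)"
      by (intro has_derivative_sum has_derivative_mult bounded_linear_imp_has_derivative bounded_linear_coords)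
    moreover have "(\<Sum>s\<in>UNIV. fst z0 $ s $ i * fst (snd z0) $ s $ j * snd (snd h) $ s $ l
         + (fst z0 $ s $ i * fst (snd h) $ s $ j + fst h $ s $ i * fst (snd z0) $ s $ j) * snd (snd z0) $ s $ l)
      = D h $ i $ j $ l" for h
    proof -
      have "(\<Sum>s\<in>UNIV. (a s $ i * fst (snd h) $ s $ j + fst h $ s $ i * b s $ j) * mat 1 $ s $ l)
        = (\<Sum>s\<in>UNIV. if s = l then a l $ i * fst (snd h) $ l $ j + fst h $ l $ i * b l $ j else 0)"
        by (rule sum.cong) (auto simp: mat_def)
      then show ?thesis by (simp add: z0_def D_def sum.distrib)
    qed
    ultimately show "((\<lambda>z. \<Psi> z $ i $ j $ l) has_derivative (\<lambda>h. D h $ i $ j $ l)) (at z0)"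
      by (simp add: \<Psi>_def)
  qed
  have linD: "linear D" using der has_derivative_linear by blast
  \<comment> \<open>Different slices of \<open>D h\<close> depend on disjoint blocks of h, so the
    tangent condition can be applied to each slice of E separately.\<close>
  have "surj D"
  unfolding surj_def
  proof (intro allI)
    fix E :: "real^'q^'n^'m"
    have "\<exists>\<delta>a \<delta>b v. (\<chi> i j. E $ i $ j $ s) = outer2 \<delta>a (b s) + outer2 (a s) \<delta>b + contract T v" for s
      using tangent by blast
    then obtain \<delta>a \<delta>b v where
      *: "\<And>s. (\<chi> i j. E $ i $ j $ s) = outer2 (\<delta>a s) (b s) + outer2 (a s) (\<delta>b s) + contract T (v s)"
      by metis
    have "E $ i $ j $ l = D ((\<chi> s. \<delta>a s), (\<chi> s. \<delta>b s), (\<chi> s l. v l $ s)) $ i $ j $ l" for i j l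
    proof -
      have "E $ i $ j $ l = (outer2 (\<delta>a l) (b l) + outer2 (a l) (\<delta>b l) + contract T (v l)) $ i $ j"
        by (subst *[symmetric]) simp
      then show ?thesis by (simp add: D_def outer2_def contract_def T)
    qed
    then show "\<exists>h. E = D h"
      by (intro exI[of _ "((\<chi> s. \<delta>a s), (\<chi> s. \<delta>b s), (\<chi> s l. v l $ s))"]) (simp add: vec_eq_iff)
  qed
  then obtain g where g: "linear g" "D \<circ> g = id"
    using linear_surjective_right_inverse[OF linD] by blast
  have "continuous_on UNIV \<Psi>"
    unfolding \<Psi>_def
    by (intro continuous_on_vec_lambda continuous_on_sum continuous_on_mult
        linear_continuous_on bounded_linear_coords)
  then have "\<Psi> z0 \<in> interior (\<Psi> ` UNIV)"
    using sussmann_open_mapping[of UNIV \<Psi> z0 D g UNIV] der g linear_conv_bounded_linear by auto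
  moreover have "\<Psi> z0 = T"
  proof -
    have "(\<Sum>s\<in>UNIV. a s $ i * b s $ j * mat 1 $ s $ l) = (\<Sum>s\<in>UNIV. if s = l then a l $ i * b l $ j else 0)"
      for i j l by (rule sum.cong) (auto simp: mat_def)
    then show ?thesis by (simp add: \<Psi>_def z0_def T vec_eq_iff)
  qed
  moreover have "range \<Psi> \<subseteq> {T. tensor_rank T \<le> CARD('q)}"
  proof safe
    fix a b and Q :: "real^'q^'q"
    have "\<Psi> (a, b, Q) = (\<Sum>s\<in>UNIV. outer3 (a $ s) (b $ s) (Q $ s))"
      by (simp add: \<Psi>_def outer3_def vec_eq_iff)
    from tensor_rank_le_sum[OF _ this] show "tensor_rank (\<Psi> (a, b, Q)) \<le> CARD('q)" by simp
  qed
  ultimately show ?thesis using interior_mono by blast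
qed

section \<open>Linear actions on the three factors\<close>

definition act12 :: "real^'m^'m1 \<Rightarrow> real^'n^'n1 \<Rightarrow> real^'p^'n^'m \<Rightarrow> real^'p^'n1^'m1" where
  "act12 P Q T = (\<chi> i j l. \<Sum>i'\<in>UNIV. \<Sum>j'\<in>UNIV. P $ i $ i' * Q $ j $ j' * T $ i' $ j' $ l)"

definition act3 :: "real^'p^'p1 \<Rightarrow> real^'p^'n^'m \<Rightarrow> real^'p1^'n^'m" where
  "act3 R T = (\<chi> i j. R *v (T $ i $ j))"

lemma linear_act12: "linear (act12 P Q)"
  by (rule linearI) (simp_all add: act12_def vec_eq_iff algebra_simps sum.distrib sum_distrib_left)

lemma linear_act3: "linear (act3 R)"
  by (rule linearI) (simp_all add: act3_def vec_eq_iff matrix_vector_right_distrib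
      matrix_vector_mult_scaleR)

lemma act12_outer3: "act12 P Q (outer3 a b c) = outer3 (P *v a) (Q *v b) c"
proof -
  have "(\<Sum>i'\<in>UNIV. \<Sum>j'\<in>UNIV. P $ i $ i' * Q $ j $ j' * (a $ i' * b $ j' * c $ l))
    = (\<Sum>i'\<in>UNIV. P $ i $ i' * a $ i') * (\<Sum>j'\<in>UNIV. Q $ j $ j' * b $ j') * c $ l" for i j l
    unfolding sum_product unfolding sum_distrib_right by (simp add: mult_ac)
  then show ?thesis by (simp add: act12_def outer3_def vec_eq_iff matrix_vector_mult_def)
qed

lemma act3_outer3: "act3 R (outer3 a b c) = outer3 a b (R *v c)"
  by (simp add: act3_def outer3_def vec_eq_iff matrix_vector_mult_def
      sum_distrib_left algebra_simps)

lemma act12_act12: "act12 P Q (act12 P' Q' T) = act12 (P ** P') (Q ** Q') T"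
proof -
  have "(\<Sum>i'\<in>UNIV. \<Sum>j'\<in>UNIV. P $ i $ i' * Q $ j $ j' * (\<Sum>i''\<in>UNIV. \<Sum>j''\<in>UNIV. P' $ i' $ i'' * Q' $ j' $ j'' * T $ i'' $ j'' $ l))
    = (\<Sum>i''\<in>UNIV. \<Sum>j''\<in>UNIV. (\<Sum>i'\<in>UNIV. P $ i $ i' * P' $ i' $ i'') * (\<Sum>j'\<in>UNIV. Q $ j $ j' * Q' $ j' $ j'') * T $ i'' $ j'' $ l)"
    (is "?L = ?R") for i j l
  proof -
    have "?L = (\<Sum>i'\<in>UNIV. \<Sum>j'\<in>UNIV. \<Sum>i''\<in>UNIV. \<Sum>j''\<in>UNIV. P $ i $ i' * P' $ i' $ i'' * (Q $ j $ j' * Q' $ j' $ j'') * T $ i'' $ j'' $ l)"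
      by (simp add: sum_distrib_left mult_ac)
    also have "\<dots> = (\<Sum>i'\<in>UNIV. \<Sum>i''\<in>UNIV. \<Sum>j'\<in>UNIV. \<Sum>j''\<in>UNIV. P $ i $ i' * P' $ i' $ i'' * (Q $ j $ j' * Q' $ j' $ j'') * T $ i'' $ j'' $ l)"
      by (rule sum.cong[OF refl], rule sum.swap)
    also have "\<dots> = (\<Sum>i''\<in>UNIV. \<Sum>i'\<in>UNIV. \<Sum>j'\<in>UNIV. \<Sum>j''\<in>UNIV. P $ i $ i' * P' $ i' $ i'' * (Q $ j $ j' * Q' $ j' $ j'') * T $ i'' $ j'' $ l)"
      by (rule sum.swap)
    also have "\<dots> = (\<Sum>i''\<in>UNIV. \<Sum>i'\<in>UNIV. \<Sum>j''\<in>UNIV. \<Sum>j'\<in>UNIV. P $ i $ i' * P' $ i' $ i'' * (Q $ j $ j' * Q' $ j' $ j'') * T $ i'' $ j'' $ l)"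
      by (intro sum.cong[OF refl], rule sum.swap)
    also have "\<dots> = (\<Sum>i''\<in>UNIV. \<Sum>j''\<in>UNIV. \<Sum>i'\<in>UNIV. \<Sum>j'\<in>UNIV. P $ i $ i' * P' $ i' $ i'' * (Q $ j $ j' * Q' $ j' $ j'') * T $ i'' $ j'' $ l)"
      by (intro sum.cong[OF refl], rule sum.swap)
    also have "\<dots> = ?R"
      unfolding sum_product unfolding sum_distrib_right ..
    finally show ?thesis .
  qed
  then show ?thesis by (simp add: act12_def matrix_matrix_mult_def)
qed

lemma act12_id: "act12 (mat 1) (mat 1) T = T"
proof -
  have "(\<Sum>i'\<in>UNIV. \<Sum>j'\<in>UNIV. mat 1 $ i $ i' * mat 1 $ j $ j' * T $ i' $ j' $ l)
    = (\<Sum>i'\<in>UNIV. if i' = i then \<Sum>j'\<in>UNIV. if j' = j then T $ i $ j $ l else 0 else 0)" for i j l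
  proof (intro sum.cong refl)
    fix i'
    have "(\<Sum>j'\<in>UNIV. mat 1 $ i $ i' * mat 1 $ j $ j' * T $ i' $ j' $ l)
        = (\<Sum>j'\<in>UNIV. if j' = j then (if i' = i then T $ i $ j $ l else 0) else 0)"
      by (rule sum.cong) (auto simp: mat_def)
    then show "(\<Sum>j'\<in>UNIV. mat 1 $ i $ i' * mat 1 $ j $ j' * T $ i' $ j' $ l)
        = (if i' = i then \<Sum>j'\<in>UNIV. if j' = j then T $ i $ j $ l else 0 else 0)" by simp
  qed
  then show ?thesis by (simp add: act12_def vec_eq_iff)
qed

lemma act3_act3: "act3 R (act3 R' T) = act3 (R ** R') T"
  by (simp add: act3_def vec_eq_iff matrix_vector_mul_assoc)

lemma act3_id: "act3 (mat 1) T = T"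
  by (simp add: act3_def vec_eq_iff)

lemma contract_act3: "contract (act3 R T) v = contract T (transpose R *v v)"
proof -
  have "(\<Sum>l\<in>UNIV. (\<Sum>k\<in>UNIV. R $ l $ k * T $ i $ j $ k) * v $ l)
     = (\<Sum>k\<in>UNIV. T $ i $ j $ k * (\<Sum>l\<in>UNIV. R $ l $ k * v $ l))" for i j
    unfolding sum_distrib_left sum_distrib_right
    by (subst sum.swap) (simp add: mult_ac)
  then show ?thesis
    by (simp add: contract_def act3_def matrix_vector_mult_def transpose_def vec_eq_iff)
qed

lemma contract_act12_outer2:
  assumes "contract T v = outer2 x y"
  shows "contract (act12 P Q T) v = outer2 (P *v x) (Q *v y)"
proof -
  have xy: "(\<Sum>l\<in>UNIV. T $ i $ j $ l * v $ l) = x $ i * y $ j" for i j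
    using assms by (auto simp: contract_def outer2_def vec_eq_iff)
  have "(\<Sum>l\<in>UNIV. (\<Sum>i'\<in>UNIV. \<Sum>j'\<in>UNIV. P $ i $ i' * Q $ j $ j' * T $ i' $ j' $ l) * v $ l)
      = (\<Sum>i'\<in>UNIV. \<Sum>j'\<in>UNIV. P $ i $ i' * Q $ j $ j' * (\<Sum>l\<in>UNIV. T $ i' $ j' $ l * v $ l))" for i j
    unfolding sum_distrib_left sum_distrib_right
    by (subst sum.swap, rule sum.cong[OF refl], subst sum.swap) (simp add: mult_ac)
  moreover have "(\<Sum>i'\<in>UNIV. \<Sum>j'\<in>UNIV. P $ i $ i' * Q $ j $ j' * (x $ i' * y $ j'))
      = (\<Sum>i'\<in>UNIV. P $ i $ i' * x $ i') * (\<Sum>j'\<in>UNIV. Q $ j $ j' * y $ j')" for i j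
    by (simp only: sum_product) (simp add: mult_ac)
  ultimately show ?thesis
    by (simp add: contract_def act12_def outer2_def xy matrix_vector_mult_def vec_eq_iff)
qed

lemma closure_interior_rank_act12:
  fixes T :: "real^'p^'n^'m" and P :: "real^'m^'m1" and Q :: "real^'n^'n1"
  assumes "P ** P' = mat 1" "Q ** Q' = mat 1"
    and "T \<in> closure (interior {T. tensor_rank T \<le> r})"
  shows "act12 P Q T \<in> closure (interior {T. tensor_rank T \<le> r})"
proof (rule closure_interior_rank_image[OF linear_act12 _ _ assms(3)])
  show "surj (act12 P Q :: real^'p^'n^'m \<Rightarrow> _)"
    by (rule surjI[of _ "act12 P' Q'"]) (simp add: act12_act12 assms act12_id)
qed (use act12_outer3 in blast)

lemma closure_interior_rank_act3:
  fixes T :: "real^'p^'n^'m" and R :: "real^'p^'p1"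
  assumes "R ** R' = mat 1"
    and "T \<in> closure (interior {T. tensor_rank T \<le> r})"
  shows "act3 R T \<in> closure (interior {T. tensor_rank T \<le> r})"
proof (rule closure_interior_rank_image[OF linear_act3 _ _ assms(2)])
  show "surj (act3 R :: real^'p^'n^'m \<Rightarrow> _)"
    by (rule surjI[of _ "act3 R'"]) (simp add: act3_act3 assms act3_id)
qed (use act3_outer3 in blast)

section \<open>Curves of rank-one matrices\<close>

text \<open>As t tends to 0 from the right, the bound forces the constant coefficient to vanish;
  dividing by t then lowers K by one.\<close>

lemma coeff_eq_0_if_poly_le_power:
  fixes q :: "real poly"
  assumes "\<delta> > 0" and "\<And>t. 0 < t \<Longrightarrow> t \<le> \<delta> \<Longrightarrow> \<bar>poly q t\<bar> \<le> C * t ^ K" and "d < K"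
  shows "coeff q d = 0"
  using assms(2,3)
proof (induction K arbitrary: q d)
  case (Suc K)
  obtain a q' where q: "q = pCons a q'" by (cases q) auto
  have ev: "\<forall>\<^sub>F t in at_right 0. 0 < t \<and> t \<le> \<delta>"
    using \<open>\<delta> > 0\<close> by (auto simp: eventually_at_right_field intro!: exI[of _ \<delta>])
  have "(poly q \<longlongrightarrow> 0) (at_right 0)"
  proof (rule Lim_null_comparison)
    show "\<forall>\<^sub>F t in at_right 0. norm (poly q t) \<le> C * t ^ Suc K"
      using ev by eventually_elim (use Suc.prems in auto)
    have "((\<lambda>t. C * t ^ Suc K) \<longlongrightarrow> C * 0 ^ Suc K) (at_right 0)" by (intro tendsto_intros)
    then show "((\<lambda>t. C * t ^ Suc K) \<longlongrightarrow> 0) (at_right 0)" by simp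
  qed
  moreover have "(poly q \<longlongrightarrow> poly q 0) (at_right 0)"
    by (intro tendsto_poly tendsto_ident_at)
  ultimately have a: "a = 0"
    using tendsto_unique[OF trivial_limit_at_right_real] q by fastforce
  show ?case
  proof (cases d)
    case (Suc d')
    have "\<bar>poly q' t\<bar> \<le> C * t ^ K" if "0 < t" "t \<le> \<delta>" for t
      using Suc.prems(1)[OF that] that by (simp add: q a abs_mult)
    then have "coeff q' d' = 0" using Suc.IH[of q' d'] Suc.prems(2) Suc by simp
    then show ?thesis by (simp add: q Suc)
  qed (simp add: q a)
qed simp

text \<open>The matrix entries at \<open>\<kappa> l\<close> serve as coordinates on the span of the slices. Near the rank-one
  matrix with the single entry \<open>1\<close> at \<open>(i0, j0)\<close>, the entries outside row \<open>i0\<close> and column \<open>j0\<close> are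
  products of those in them, so all of them have to be coordinates.\<close>

locale chart =
  fixes \<kappa> :: "'q::finite \<Rightarrow> 'm::finite \<times> 'n::finite" and i0 :: 'm and j0 :: 'n and l0 :: 'q
  assumes \<kappa>_l0: "\<kappa> l0 = (i0, j0)"
    and \<kappa>_core: "\<And>i j. i \<noteq> i0 \<Longrightarrow> j \<noteq> j0 \<Longrightarrow> \<exists>l. \<kappa> l = (i, j)"
begin

text \<open>The slices are the basis of their span dual to the coordinates at
  \<open>\<kappa>\<close>, so the span is a graph over these; slice \<open>l0\<close> is the
  rank-one base matrix.\<close>

definition normal :: "real^'q^'n^'m \<Rightarrow> bool" where
  "normal T \<longleftrightarrow> (\<forall>l l'. T $ fst (\<kappa> l') $ snd (\<kappa> l') $ l = of_bool (l = l')) \<and>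
     (\<forall>i j. T $ i $ j $ l0 = of_bool (i = i0 \<and> j = j0))"

text \<open>A rank-one matrix with entry 1 at \<open>(i0, j0)\<close> is determined by row
  \<open>i0\<close> and column \<open>j0\<close>. These are the coordinates so determined; the
  others are free.\<close>

definition core :: "'q set" where
  "core = {l. fst (\<kappa> l) \<noteq> i0 \<and> snd (\<kappa> l) \<noteq> j0}"

text \<open>A fixed point \<open>v\<close> of \<open>step\<close> yields the rank-one matrix \<open>contract T v\<close> in the span of the
  slices; its entries at \<open>\<kappa> l\<close>, \<open>l \<notin> core\<close>, are the prescribed values \<open>w l\<close>.\<close>

definition step :: "('m \<Rightarrow> 'n \<Rightarrow> 'q \<Rightarrow> 'a::comm_ring_1) \<Rightarrow> ('q \<Rightarrow> 'a) \<Rightarrow> ('q \<Rightarrow> 'a) \<Rightarrow> 'q \<Rightarrow> 'a" where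
  "step c w v l = (if l \<in> core
     then (\<Sum>k\<in>UNIV. c (fst (\<kappa> l)) j0 k * v k) * (\<Sum>k\<in>UNIV. c i0 (snd (\<kappa> l)) k * v k) else w l)"

text \<open>Fixed-point iteration for \<open>step\<close> on polynomials in the curve parameter;
  \<open>step\<close> is stated over a general ring to serve both here and for real numbers.\<close>

fun approx :: "real^'q^'n^'m \<Rightarrow> ('q \<Rightarrow> real poly) \<Rightarrow> nat \<Rightarrow> 'q \<Rightarrow> real poly" where
  "approx T W 0 = (\<lambda>l. if l \<in> core then 0 else W l)"
| "approx T W (Suc n) = step (\<lambda>i j k. [:T $ i $ j $ k:]) W (approx T W n)"

text \<open>The iteration only adds and multiplies, so each Taylor coefficient is polynomial in T.
  This makes the spanning condition below Zariski open.\<close>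

lemma real_polynomial_function_coeff_approx:
  "real_polynomial_function (\<lambda>T. coeff (approx T W n l) d)"
proof (induction n arbitrary: l d)
  case 0
  show ?case by (simp add: real_polynomial_function.intros(2))
next
  case (Suc n)
  have "real_polynomial_function (\<lambda>T. \<Sum>e\<le>d.
      (\<Sum>k\<in>UNIV. T $ fst (\<kappa> l) $ j0 $ k * coeff (approx T W n k) e) *
      (\<Sum>k\<in>UNIV. T $ i0 $ snd (\<kappa> l) $ k * coeff (approx T W n k) (d - e)))"
    by (intro real_polynomial_function_sum real_polynomial_function.intros(4) Suc
        real_polynomial_function_entry) auto
  then show ?case
    by (cases "l \<in> core")
       (simp_all add: step_def coeff_mult coeff_sum real_polynomial_function.intros(2))
qed

definition curve :: "('q \<Rightarrow> real poly) \<Rightarrow> bool" where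
  "curve W \<longleftrightarrow> W l0 = 1 \<and> (\<forall>l. l \<noteq> l0 \<longrightarrow> coeff (W l) 0 = 0)"

text \<open>An actual fixed point at parameter t, as opposed to the formal iterates
  \<open>approx\<close>; the bound \<open>C * t\<close> keeps it near the base matrix.\<close>

definition solution :: "real^'q^'n^'m \<Rightarrow> ('q \<Rightarrow> real poly) \<Rightarrow> real \<Rightarrow> real \<Rightarrow> real^'q \<Rightarrow> bool" where
  "solution T W C t v \<longleftrightarrow> v $ l0 = 1 \<and> (\<forall>l. l \<noteq> l0 \<longrightarrow> \<bar>v $ l\<bar> \<le> C * t) \<and>
     (\<forall>l. v $ l = step (\<lambda>i j k. T $ i $ j $ k) (\<lambda>l. poly (W l) t) (($) v) l)"

lemma solutionD:
  assumes "solution T W C t v"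
  shows "v $ l0 = 1" and "l \<noteq> l0 \<Longrightarrow> \<bar>v $ l\<bar> \<le> C * t"
    and "v $ l = step (\<lambda>i j k. T $ i $ j $ k) (\<lambda>l. poly (W l) t) (($) v) l"
  using assms by (auto simp: solution_def)

definition total :: "real^'q^'n^'m \<Rightarrow> real" where
  "total T = (\<Sum>i\<in>UNIV. \<Sum>j\<in>UNIV. \<Sum>k\<in>UNIV. \<bar>T $ i $ j $ k\<bar>)"

lemma total_nonneg: "total T \<ge> 0"
  by (simp add: total_def sum_nonneg)

lemma row_le_total: "(\<Sum>k\<in>UNIV. \<bar>T $ i $ j $ k\<bar>) \<le> total T"
proof -
  have "(\<Sum>k\<in>UNIV. \<bar>T $ i $ j $ k\<bar>) \<le> (\<Sum>j\<in>UNIV. \<Sum>k\<in>UNIV. \<bar>T $ i $ j $ k\<bar>)"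
    by (rule member_le_sum[of j UNIV "\<lambda>j. \<Sum>k\<in>UNIV. \<bar>T $ i $ j $ k\<bar>"]) (auto intro: sum_nonneg)
  also have "\<dots> \<le> total T"
    unfolding total_def
    by (rule member_le_sum[of i UNIV "\<lambda>i. \<Sum>j\<in>UNIV. \<Sum>k\<in>UNIV. \<bar>T $ i $ j $ k\<bar>"])
       (auto intro: sum_nonneg)
  finally show ?thesis .
qed

text \<open>The alternative of a vanishing entry covers slice \<open>l0\<close>, where the solutions
  have the value 1 and are not small.\<close>

lemma abs_row_le:
  assumes "B \<ge> 0" and "\<And>k. T $ i $ j $ k = 0 \<or> \<bar>u k\<bar> \<le> B"
  shows "\<bar>\<Sum>k\<in>UNIV. T $ i $ j $ k * u k\<bar> \<le> total T * B"
proof -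
  have "\<bar>\<Sum>k\<in>UNIV. T $ i $ j $ k * u k\<bar> \<le> (\<Sum>k\<in>UNIV. \<bar>T $ i $ j $ k * u k\<bar>)" by (rule sum_abs)
  also have "\<dots> \<le> (\<Sum>k\<in>UNIV. \<bar>T $ i $ j $ k\<bar> * B)"
  proof (rule sum_mono)
    fix k show "\<bar>T $ i $ j $ k * u k\<bar> \<le> \<bar>T $ i $ j $ k\<bar> * B"
      using assms(2)[of k] by (auto simp: abs_mult intro: mult_left_mono)
  qed
  also have "\<dots> \<le> total T * B"
    using row_le_total[of T i j] assms(1) by (simp add: sum_distrib_right[symmetric] mult_right_mono)
  finally show ?thesis .
qed

lemma normal_l0: "normal T \<Longrightarrow> i \<noteq> i0 \<or> j \<noteq> j0 \<Longrightarrow> T $ i $ j $ l0 = 0"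
  by (auto simp: normal_def)

lemma poly_bound_unit:
  fixes q :: "real poly"
  assumes "coeff q 0 = 0"
  obtains C where "C \<ge> 0" "\<And>t. 0 < t \<Longrightarrow> t \<le> 1 \<Longrightarrow> \<bar>poly q t\<bar> \<le> C * t"
proof -
  obtain q' where q: "q = pCons 0 q'" using assms by (cases q) auto
  have "bounded (poly q' ` {0..1})"
    by (intro compact_imp_bounded compact_continuous_image continuous_intros) auto
  then obtain C where C: "\<And>x. x \<in> {0..1} \<Longrightarrow> \<bar>poly q' x\<bar> \<le> C"
    unfolding bounded_iff by (metis imageI real_norm_def)
  have "\<bar>poly q t\<bar> \<le> C * t" if "0 < t" "t \<le> 1" for t
    using C[of t] that by (simp add: q abs_mult mult.commute mult_left_mono)
  moreover have "C \<ge> 0" using C[of 0] by auto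
  ultimately show ?thesis using that by blast
qed

text \<open>Brouwer's theorem on the box of vectors with entry 1 at \<open>l0\<close> and the others
  bounded by \<open>C * t\<close>. By normality both factors of a core value are O(t), so the value
  is O(t^2) and stays in the box for small t.\<close>

lemma solution_exists:
  assumes T: "normal T" and W: "curve W"
  obtains C \<delta> where "C > 0" "\<delta> > 0" "\<And>t. 0 < t \<Longrightarrow> t \<le> \<delta> \<Longrightarrow> \<exists>v. solution T W C t v"
proof -
  have "\<exists>C. C \<ge> 0 \<and> (\<forall>t. 0 < t \<longrightarrow> t \<le> 1 \<longrightarrow> \<bar>poly (W l) t\<bar> \<le> C * t)" if "l \<noteq> l0" for l
    using W poly_bound_unit[of "W l"] that unfolding curve_def by metis
  then obtain c where c: "\<And>l. l \<noteq> l0 \<Longrightarrow> c l \<ge> 0"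
    "\<And>l t. l \<noteq> l0 \<Longrightarrow> 0 < t \<Longrightarrow> t \<le> 1 \<Longrightarrow> \<bar>poly (W l) t\<bar> \<le> c l * t" by metis
  \<comment> \<open>Dominates the growth constants of all prescribed coordinates; the summand 1
    makes it positive.\<close>
  define C where "C = 1 + (\<Sum>l\<in>UNIV-{l0}. c l)"
  have cC: "c l \<le> C" if "l \<noteq> l0" for l
    using member_le_sum[of l "UNIV-{l0}" c] c(1) that by (auto simp: C_def)
  have C: "C > 0" unfolding C_def using c(1) by (auto intro!: add_pos_nonneg sum_nonneg)
  define M where "M = total T"
  have M: "M \<ge> 0" by (simp add: M_def total_nonneg)
  \<comment> \<open>Ensures \<open>M * M * C * t \<le> 1\<close>, which reduces the bound
    \<open>(M * C * t)^2\<close> on core values to \<open>C * t\<close>.\<close>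
  define \<delta> where "\<delta> = min 1 (1 / (M * M * C + 1))"
  have pos: "M * M * C + 1 > 0" using M C by (simp add: add_nonneg_pos)
  have "\<delta> > 0" using pos by (simp add: \<delta>_def)
  moreover have "\<exists>v. solution T W C t v" if t: "0 < t" "t \<le> \<delta>" for t
  proof -
    have t1: "t \<le> 1" and "t \<le> 1 / (M * M * C + 1)" using t by (auto simp: \<delta>_def)
    then have "t * (M * M * C + 1) \<le> 1" using pos by (simp add: field_simps)
    then have t2: "M * M * C * t \<le> 1" using t by (simp add: algebra_simps)
    \<comment> \<open>The box has width zero in direction \<open>l0\<close>, which fixes that
      coordinate to 1.\<close>
    define lo hi :: "real^'q" where "lo = (\<chi> l. if l = l0 then 1 else - (C * t))"
      and "hi = (\<chi> l. if l = l0 then 1 else C * t)"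
    have box: "v \<in> cbox lo hi \<longleftrightarrow> v $ l0 = 1 \<and> (\<forall>l. l \<noteq> l0 \<longrightarrow> \<bar>v $ l\<bar> \<le> C * t)" for v
    proof -
      have "(lo $ l \<le> v $ l \<and> v $ l \<le> hi $ l) \<longleftrightarrow> (if l = l0 then v $ l0 = 1 else \<bar>v $ l\<bar> \<le> C * t)" for l
        unfolding lo_def hi_def by (cases "l = l0") (simp_all, linarith+)
      then show ?thesis unfolding mem_box_cart by metis
    qed
    define \<Phi> :: "real^'q \<Rightarrow> real^'q" where
      "\<Phi> v = (\<chi> l. step (\<lambda>i j k. T $ i $ j $ k) (\<lambda>l. poly (W l) t) (($) v) l)" for v
    have "continuous_on (cbox lo hi) \<Phi>"
      unfolding \<Phi>_def
    proof (rule continuous_on_vec_lambda)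
      fix l
      show "continuous_on (cbox lo hi) (\<lambda>v. step (\<lambda>i j k. T $ i $ j $ k) (\<lambda>l. poly (W l) t) (($) v) l)"
        unfolding step_def by (cases "l \<in> core") (auto intro!: continuous_intros)
    qed
    moreover have "\<Phi> v \<in> cbox lo hi" if "v \<in> cbox lo hi" for v
    proof -
      have v: "v $ l0 = 1" "\<And>l. l \<noteq> l0 \<Longrightarrow> \<bar>v $ l\<bar> \<le> C * t" using that box by auto
      have row: "\<bar>\<Sum>k\<in>UNIV. T $ i $ j $ k * v $ k\<bar> \<le> M * (C * t)" if "i \<noteq> i0 \<or> j \<noteq> j0" for i j
        unfolding M_def by (rule abs_row_le) (use C t v(2) normal_l0[OF T that] in force)+
      have "\<bar>\<Phi> v $ l\<bar> \<le> C * t" if "l \<noteq> l0" for l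
      proof (cases "l \<in> core")
        case True
        then have "\<bar>\<Phi> v $ l\<bar> = \<bar>\<Sum>k\<in>UNIV. T $ fst (\<kappa> l) $ j0 $ k * v $ k\<bar> *
            \<bar>\<Sum>k\<in>UNIV. T $ i0 $ snd (\<kappa> l) $ k * v $ k\<bar>"
          by (simp add: \<Phi>_def step_def abs_mult)
        also have "\<dots> \<le> (M * (C * t)) * (M * (C * t))"
          using True M C t by (intro mult_mono row) (auto simp: core_def)
        also have "\<dots> = (M * M * C * t) * (C * t)" by simp
        also have "\<dots> \<le> 1 * (C * t)" using t2 C t by (intro mult_right_mono) auto
        finally show ?thesis by simp
      next
        case False
        have "\<bar>poly (W l) t\<bar> \<le> c l * t" using c(2) that t t1 by blast
        also have "\<dots> \<le> C * t" using cC[OF that] t by (intro mult_right_mono) auto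
        finally show ?thesis using False by (simp add: \<Phi>_def step_def)
      qed
      moreover have "\<Phi> v $ l0 = 1"
        using W by (simp add: \<Phi>_def step_def core_def \<kappa>_l0 curve_def)
      ultimately show ?thesis using box by blast
    qed
    moreover have "cbox lo hi \<noteq> {}"
      using box[of hi] C t by (auto simp: hi_def)
    ultimately obtain v where v: "v \<in> cbox lo hi" "\<Phi> v = v"
      using brouwer[of "cbox lo hi" \<Phi>] by (auto simp: convex_box compact_cbox)
    have "v $ l = step (\<lambda>i j k. T $ i $ j $ k) (\<lambda>l. poly (W l) t) (($) v) l" for l
      by (subst v(2)[symmetric]) (simp add: \<Phi>_def)
    then have "solution T W C t v" using v(1) box unfolding solution_def by blast
    then show ?thesis ..
  qed
  ultimately show ?thesis using that[of C \<delta>] C by blast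
qed

text \<open>A core value is a product of two factors of order t, so an error in one factor is
  multiplied by O(t) and each iteration gains a power of t. The constant is uniform in t and
  v.\<close>

lemma solution_approx:
  assumes T: "normal T" and W: "curve W" and C: "C > 0"
  shows "\<exists>C'\<ge>0. \<forall>t v. 0 < t \<longrightarrow> t \<le> 1 \<longrightarrow> solution T W C t v \<longrightarrow>
     (\<forall>l. \<bar>v $ l - poly (approx T W n l) t\<bar> \<le> C' * t ^ Suc n)"
proof (induction n)
  case 0
  have "\<bar>v $ l - poly (approx T W 0 l) t\<bar> \<le> C * t"
    if t: "0 < t" and s: "solution T W C t v" for t v l
  proof (cases "l \<in> core")
    case True
    then have "l \<noteq> l0" using \<kappa>_l0 by (auto simp: core_def)
    then show ?thesis using solutionD(2)[OF s] True by simp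
  next
    case False
    then have "v $ l = poly (W l) t" using s by (simp add: solution_def step_def)
    then show ?thesis using False C t by simp
  qed
  then show ?case using C by (intro exI[of _ C]) auto
next
  case (Suc n)
  then obtain C' where C': "C' \<ge> 0" "\<And>t v l. 0 < t \<Longrightarrow> t \<le> 1 \<Longrightarrow> solution T W C t v \<Longrightarrow>
     \<bar>v $ l - poly (approx T W n l) t\<bar> \<le> C' * t ^ Suc n" by blast
  define M where "M = total T"
  have M: "M \<ge> 0" by (simp add: M_def total_nonneg)
  \<comment> \<open>Collects the constants from
    \<open>a * b - a' * b' = (a - a') * b + a' * (b - b')\<close>.\<close>
  define C'' where "C'' = M * C' * (M * C) + (M * C + M * C') * (M * C')"
  have C''0: "C'' \<ge> 0" using M C C' by (simp add: C''_def)
  have "\<bar>v $ l - poly (approx T W (Suc n) l) t\<bar> \<le> C'' * t ^ Suc (Suc n)"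
    if t: "0 < t" "t \<le> 1" and s: "solution T W C t v" for t v l
  proof (cases "l \<in> core")
    case True
    define V where "V k = poly (approx T W n k) t" for k
    have dV: "\<bar>v $ k - V k\<bar> \<le> C' * t ^ Suc n" for k
      using C'(2)[OF t s] by (simp add: V_def)
    have row: "\<bar>\<Sum>k\<in>UNIV. T $ i $ j $ k * v $ k\<bar> \<le> M * (C * t)" if "i \<noteq> i0 \<or> j \<noteq> j0" for i j
      unfolding M_def
      by (rule abs_row_le) (use C t s normal_l0[OF T that] in \<open>force simp: solution_def\<close>)+
    have drow: "\<bar>(\<Sum>k\<in>UNIV. T $ i $ j $ k * v $ k) - (\<Sum>k\<in>UNIV. T $ i $ j $ k * V k)\<bar> \<le> M * (C' * t ^ Suc n)"
      for i j
    proof -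
      have "\<bar>\<Sum>k\<in>UNIV. T $ i $ j $ k * (v $ k - V k)\<bar> \<le> M * (C' * t ^ Suc n)"
        unfolding M_def by (rule abs_row_le) (use dV C'(1) t in auto)
      then show ?thesis by (simp add: right_diff_distrib sum_subtractf)
    qed
    define a b a' b' where ab: "a = (\<Sum>k\<in>UNIV. T $ fst (\<kappa> l) $ j0 $ k * v $ k)"
      "b = (\<Sum>k\<in>UNIV. T $ i0 $ snd (\<kappa> l) $ k * v $ k)"
      "a' = (\<Sum>k\<in>UNIV. T $ fst (\<kappa> l) $ j0 $ k * V k)"
      "b' = (\<Sum>k\<in>UNIV. T $ i0 $ snd (\<kappa> l) $ k * V k)"
    have bds: "\<bar>a\<bar> \<le> M * (C * t)" "\<bar>b\<bar> \<le> M * (C * t)" "\<bar>a - a'\<bar> \<le> M * (C' * t ^ Suc n)"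
      "\<bar>b - b'\<bar> \<le> M * (C' * t ^ Suc n)"
      using True row drow by (auto simp: ab core_def)
    have "t ^ Suc n \<le> t" using t power_le_one[of t n] by (simp add: mult_left_le)
    then have "M * (C' * t ^ Suc n) \<le> M * (C' * t)" using M C' by (intro mult_left_mono) auto
    then have a': "\<bar>a'\<bar> \<le> (M * C + M * C') * t" using bds by (simp add: algebra_simps)
    have "v $ l - poly (approx T W (Suc n) l) t = a * b - a' * b'"
    proof -
      have "v $ l = a * b"
        using solutionD(3)[OF s, of l] True unfolding step_def ab by simp
      moreover have "poly (approx T W (Suc n) l) t = a' * b'"
        using True by (simp add: ab V_def step_def poly_sum)
      ultimately show ?thesis by simp
    qed
    also have "\<dots> = (a - a') * b + a' * (b - b')" by (simp add: algebra_simps)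
    also have "\<bar>\<dots>\<bar> \<le> \<bar>a - a'\<bar> * \<bar>b\<bar> + \<bar>a'\<bar> * \<bar>b - b'\<bar>" by (metis abs_mult abs_triangle_ineq)
    also have "\<dots> \<le> (M * (C' * t ^ Suc n)) * (M * (C * t)) + ((M * C + M * C') * t) * (M * (C' * t ^ Suc n))"
      using M C C' t by (intro add_mono mult_mono bds a') auto
    also have "\<dots> = C'' * t ^ Suc (Suc n)" by (simp add: C''_def algebra_simps)
    finally show ?thesis .
  next
    case False
    then have "v $ l = poly (approx T W (Suc n) l) t" using s by (simp add: solution_def step_def)
    then show ?thesis using C''0 t by simp
  qed
  then show ?case using C''0 by (intro exI[of _ C'']) blast
qed

lemma contract_normal:
  assumes "normal T"
  shows "contract T v $ fst (\<kappa> l) $ snd (\<kappa> l) = v $ l"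
proof -
  have "contract T v $ fst (\<kappa> l) $ snd (\<kappa> l) = (\<Sum>k\<in>UNIV. if k = l then v $ l else 0)"
    unfolding contract_def using assms by (auto simp: normal_def intro!: sum.cong)
  then show ?thesis by simp
qed

text \<open>The entry at \<open>(i0, j0)\<close> is 1, and off its row and column the fixed-point
  equation says that an entry is the product of the corresponding column and row entries.\<close>

lemma solution_rank_one:
  assumes T: "normal T" and s: "solution T W C t v"
  shows "contract T v = outer2 (\<chi> i. contract T v $ i $ j0) (\<chi> j. contract T v $ i0 $ j)"
proof -
  note ent = contract_normal[OF T, of v]
  have e00: "contract T v $ i0 $ j0 = 1" using ent[of l0] solutionD(1)[OF s] by (simp add: \<kappa>_l0)
  have "contract T v $ i $ j = contract T v $ i $ j0 * contract T v $ i0 $ j" for i j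
  proof (cases "i = i0 \<or> j = j0")
    case False
    then obtain l where l: "\<kappa> l = (i, j)" using \<kappa>_core by blast
    then have "l \<in> core" using False by (simp add: core_def)
    then have "v $ l = (\<Sum>k\<in>UNIV. T $ i $ j0 $ k * v $ k) * (\<Sum>k\<in>UNIV. T $ i0 $ j $ k * v $ k)"
      using solutionD(3)[OF s, of l] l unfolding step_def by simp
    then show ?thesis using ent[of l] l by (simp add: contract_def)
  qed (use e00 in auto)
  then show ?thesis unfolding outer2_def vec_eq_iff vec_lambda_beta by blast
qed

text \<open>Slice \<open>l0\<close> contributes exactly the base matrix, and all other coefficients
  are at most \<open>C * t\<close>.\<close>

lemma solution_near:
  assumes T: "normal T" and s: "solution T W C t v" and Ct: "C * t \<ge> 0"
  shows "norm ((\<chi> i. contract T v $ i $ j0) - axis i0 1) \<le> CARD('m) * (total T * (C * t))"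
    and "norm ((\<chi> j. contract T v $ i0 $ j) - axis j0 1) \<le> CARD('n) * (total T * (C * t))"
proof -
  have row: "\<bar>contract T v $ i $ j - of_bool (i = i0 \<and> j = j0)\<bar> \<le> total T * (C * t)" for i j
  proof -
    have "(\<Sum>k\<in>UNIV. T $ i $ j $ k * v $ k) = T $ i $ j $ l0 * v $ l0 + (\<Sum>k\<in>UNIV-{l0}. T $ i $ j $ k * v $ k)"
      by (simp add: sum.remove)
    moreover have "(\<Sum>k\<in>UNIV. T $ i $ j $ k * (if k = l0 then 0 else v $ k)) = (\<Sum>k\<in>UNIV-{l0}. T $ i $ j $ k * v $ k)"
      by (subst sum.remove[of _ l0]) (auto intro!: sum.cong)
    ultimately have "contract T v $ i $ j - of_bool (i = i0 \<and> j = j0) =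
      (\<Sum>k\<in>UNIV. T $ i $ j $ k * (if k = l0 then 0 else v $ k))"
      using T solutionD(1)[OF s] by (simp add: contract_def normal_def)
    also have "\<bar>\<dots>\<bar> \<le> total T * (C * t)"
      by (rule abs_row_le) (use s Ct in \<open>auto simp: solution_def\<close>)
    finally show ?thesis .
  qed
  have "norm ((\<chi> i. contract T v $ i $ j0) - axis i0 1) \<le> (\<Sum>i\<in>UNIV. \<bar>((\<chi> i. contract T v $ i $ j0) - axis i0 1) $ i\<bar>)"
    by (rule norm_le_l1_cart)
  also have "\<dots> \<le> (\<Sum>i\<in>(UNIV::'m set). total T * (C * t))"
  proof (rule sum_mono)
    fix i show "\<bar>((\<chi> i. contract T v $ i $ j0) - axis i0 1) $ i\<bar> \<le> total T * (C * t)"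
      using row[of i j0] by (cases "i = i0") (auto simp: axis_def)
  qed
  finally show "norm ((\<chi> i. contract T v $ i $ j0) - axis i0 1) \<le> CARD('m) * (total T * (C * t))" by simp
  have "norm ((\<chi> j. contract T v $ i0 $ j) - axis j0 1) \<le> (\<Sum>j\<in>UNIV. \<bar>((\<chi> j. contract T v $ i0 $ j) - axis j0 1) $ j\<bar>)"
    by (rule norm_le_l1_cart)
  also have "\<dots> \<le> (\<Sum>j\<in>(UNIV::'n set). total T * (C * t))"
  proof (rule sum_mono)
    fix j show "\<bar>((\<chi> j. contract T v $ i0 $ j) - axis j0 1) $ j\<bar> \<le> total T * (C * t)"
      using row[of i0 j] by (cases "j = j0") (auto simp: axis_def)
  qed
  finally show "norm ((\<chi> j. contract T v $ i0 $ j) - axis j0 1) \<le> CARD('n) * (total T * (C * t))" by simp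
qed

end

section \<open>Perturbation to a span of rank-one matrices\<close>

lemma bilinear_outer2: "bilinear outer2"
  unfolding bilinear_def
  by (auto intro!: linearI simp: outer2_def vec_eq_iff algebra_simps)

context chart begin

text \<open>At the base matrix, tangent vectors supply row \<open>i0\<close> and column
  \<open>j0\<close> and the slices supply the core entries, linearly in M. For nearby x and y the
  same recipe gives a map \<open>G\<close> close to the identity, hence injective, hence
  surjective.\<close>

lemma tangent_near_base:
  assumes T: "normal T"
  obtains \<eta> where "\<eta> > 0"
    "\<And>x y M. norm (x - axis i0 1) \<le> \<eta> \<Longrightarrow> norm (y - axis j0 1) \<le> \<eta> \<Longrightarrow>
       \<exists>\<delta>a \<delta>b v. M = outer2 \<delta>a y + outer2 x \<delta>b + contract T v"
proof -
  define cv :: "real^'n^'m \<Rightarrow> real^'q" where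
    "cv M = (\<chi> l. if l \<in> core then M $ fst (\<kappa> l) $ snd (\<kappa> l) else 0)" for M
  define rest where "rest M = M - contract T (cv M)" for M
  define da :: "real^'n^'m \<Rightarrow> real^'m" where "da M = (\<chi> i. rest M $ i $ j0)" for M
  \<comment> \<open>The entry at \<open>(i0, j0)\<close> is already supplied by
    \<open>da\<close>.\<close>
  define db :: "real^'n^'m \<Rightarrow> real^'n" where "db M = (\<chi> j. if j = j0 then 0 else rest M $ i0 $ j)" for M
  have lin_cv: "linear cv" by (rule linearI) (auto simp: cv_def vec_eq_iff)
  have lin_c: "linear (\<lambda>M. contract T (cv M))"
    using linear_compose[OF lin_cv linear_contract] by (simp add: o_def)
  have lin_rest: "linear rest"
    unfolding rest_def by (intro linear_compose_sub linear_ident lin_c)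
  have lin_da: "linear da"
    by (rule linearI) (auto simp: da_def vec_eq_iff linear_add[OF lin_rest] linear_scale[OF lin_rest])
  have lin_db: "linear db"
    by (rule linearI) (auto simp: db_def vec_eq_iff linear_add[OF lin_rest] linear_scale[OF lin_rest])
  have base: "M = outer2 (da M) (axis j0 1) + outer2 (axis i0 1) (db M) + contract T (cv M)" for M
  proof -
    have "rest M $ i $ j = (outer2 (da M) (axis j0 1) + outer2 (axis i0 1) (db M)) $ i $ j" for i j
    proof (cases "i = i0 \<or> j = j0")
      case True
      then show ?thesis by (auto simp: outer2_def da_def db_def axis_def)
    next
      case False
      then obtain l where l: "\<kappa> l = (i, j)" using \<kappa>_core by blast
      then have "l \<in> core" using False by (simp add: core_def)
      then have "rest M $ i $ j = 0"
        using contract_normal[OF T, of "cv M" l] l by (simp add: rest_def cv_def)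
      then show ?thesis using False by (simp add: outer2_def axis_def)
    qed
    then show ?thesis by (simp add: rest_def vec_eq_iff algebra_simps)
  qed
  obtain B1 where B1: "B1 > 0" "\<And>M. norm (da M) \<le> B1 * norm M"
    using linear_bounded_pos[OF lin_da] by blast
  obtain B2 where B2: "B2 > 0" "\<And>M. norm (db M) \<le> B2 * norm M"
    using linear_bounded_pos[OF lin_db] by blast
  obtain B3 where B3: "B3 > 0" "\<And>(x::real^'m) (y::real^'n). norm (outer2 x y) \<le> B3 * norm x * norm y"
    using bilinear_bounded_pos[OF bilinear_outer2] by blast
  \<comment> \<open>Makes \<open>norm (M - G M) < norm M\<close> for nonzero M, so
    \<open>G M = 0\<close> is impossible.\<close>
  define \<eta> where "\<eta> = 1 / (B3 * (B1 + B2) + 1)"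
  have den: "B3 * (B1 + B2) + 1 > 0" using B1 B2 B3 by (simp add: add_pos_pos)
  then have \<eta>: "\<eta> > 0" by (simp add: \<eta>_def)
  have small: "B3 * (B1 + B2) * \<eta> < 1" using den by (simp add: \<eta>_def)
  show ?thesis
  proof (rule that[OF \<eta>])
    fix x :: "real^'m" and y :: "real^'n" and M0 :: "real^'n^'m"
    assume x: "norm (x - axis i0 1) \<le> \<eta>" and y: "norm (y - axis j0 1) \<le> \<eta>"
    define G where "G M = outer2 (da M) y + outer2 x (db M) + contract T (cv M)" for M
    have bl: "linear (\<lambda>a. outer2 a y)" "linear (\<lambda>b. outer2 x b)"
      using bilinear_outer2 unfolding bilinear_def by auto
    have lin_G: "linear G" unfolding G_def
      using linear_compose[OF lin_da bl(1)] linear_compose[OF lin_db bl(2)] lin_c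
      by (intro linear_compose_add) (auto simp: o_def)
    have "M = 0" if "G M = 0" for M
    proof (rule ccontr)
      assume "M \<noteq> 0"
      have "M - G M = outer2 (da M) (axis j0 1 - y) + outer2 (axis i0 1 - x) (db M)"
        by (subst base[of M]) (simp add: G_def outer2_def vec_eq_iff algebra_simps)
      then have "norm M \<le> norm (outer2 (da M) (axis j0 1 - y)) + norm (outer2 (axis i0 1 - x) (db M))"
        using that norm_triangle_ineq[of "outer2 (da M) (axis j0 1 - y)" "outer2 (axis i0 1 - x) (db M)"]
        by (metis diff_zero)
      also have "\<dots> \<le> B3 * (B1 * norm M) * \<eta> + B3 * \<eta> * (B2 * norm M)"
      proof (rule add_mono)
        have "norm (outer2 (da M) (axis j0 1 - y)) \<le> B3 * norm (da M) * norm (axis j0 1 - y)" by (rule B3)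
        also have "\<dots> \<le> B3 * (B1 * norm M) * \<eta>"
          using B1 B3(1) y \<eta> by (intro mult_mono) (auto simp: norm_minus_commute)
        finally show "norm (outer2 (da M) (axis j0 1 - y)) \<le> B3 * (B1 * norm M) * \<eta>" .
        have "norm (outer2 (axis i0 1 - x) (db M)) \<le> B3 * norm (axis i0 1 - x) * norm (db M)" by (rule B3)
        also have "\<dots> \<le> B3 * \<eta> * (B2 * norm M)"
          using B2 B3(1) x \<eta> by (intro mult_mono) (auto simp: norm_minus_commute)
        finally show "norm (outer2 (axis i0 1 - x) (db M)) \<le> B3 * \<eta> * (B2 * norm M)" .
      qed
      also have "\<dots> = (B3 * (B1 + B2) * \<eta>) * norm M" by (simp add: algebra_simps)
      also have "\<dots> < 1 * norm M" using small \<open>M \<noteq> 0\<close> by (intro mult_strict_right_mono) auto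
      finally show False by simp
    qed
    then have "surj G"
      using linear_injective_imp_surjective[OF lin_G] linear_injective_0[OF lin_G] by auto
    then obtain M where "M0 = G M" by (metis surjD)
    then show "\<exists>\<delta>a \<delta>b v. M0 = outer2 \<delta>a y + outer2 x \<delta>b + contract T v"
      unfolding G_def by blast
  qed
qed

text \<open>Row l holds one Taylor coefficient of the curve prescribed by \<open>W l\<close>.
  Invertibility forces the solutions with small t to span; q independent ones give new slices that
  are rank-one and close enough to the base matrix for the tangent condition.\<close>

lemma closure_interior_rank_if_det:
  assumes T: "normal T" and W: "\<And>l. curve (W l)" and d: "\<And>l. d l \<le> N"
    and det: "det (\<chi> l l'. coeff (approx T (W l) N l') (d l)) \<noteq> 0"
  shows "T \<in> closure (interior {T. tensor_rank T \<le> CARD('q)})"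
proof -
  obtain \<eta> where \<eta>: "\<eta> > 0"
    "\<And>x y M. norm (x - axis i0 1) \<le> \<eta> \<Longrightarrow> norm (y - axis j0 1) \<le> \<eta> \<Longrightarrow>
       \<exists>\<delta>a \<delta>b v. M = outer2 \<delta>a y + outer2 x \<delta>b + contract T v"
    using tangent_near_base[OF T] by metis
  have "\<forall>l. \<exists>C \<delta>. C > 0 \<and> \<delta> > 0 \<and> (\<forall>t. 0 < t \<longrightarrow> t \<le> \<delta> \<longrightarrow> (\<exists>v. solution T (W l) C t v))"
    using solution_exists[OF T W] by metis
  then obtain C \<delta> where C: "\<And>l. C l > 0" and \<delta>: "\<And>l. \<delta> l > 0"
    and ex: "\<And>l t. 0 < t \<Longrightarrow> t \<le> \<delta> l \<Longrightarrow> \<exists>v. solution T (W l) (C l) t v" by metis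
  have "\<forall>l. \<exists>C'\<ge>0. \<forall>t v. 0 < t \<longrightarrow> t \<le> 1 \<longrightarrow> solution T (W l) (C l) t v \<longrightarrow>
     (\<forall>k. \<bar>v $ k - poly (approx T (W l) N k) t\<bar> \<le> C' * t ^ Suc N)"
    using solution_approx[OF T W C] by blast
  then obtain C' where C': "\<And>l. C' l \<ge> 0" "\<And>l t v k. 0 < t \<Longrightarrow> t \<le> 1 \<Longrightarrow> solution T (W l) (C l) t v \<Longrightarrow>
     \<bar>v $ k - poly (approx T (W l) N k) t\<bar> \<le> C' l * t ^ Suc N" by metis
  \<comment> \<open>For \<open>t \<le> \<eta> / K l\<close> both factors lie within
    \<open>\<eta>\<close> of the basis vectors; the summand 1 makes \<open>K l\<close>
    positive.\<close>
  define K where "K l = (real CARD('m) + real CARD('n)) * (total T * C l) + 1" for l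
  have Kpos: "K l > 0" for l
    unfolding K_def using C[of l] total_nonneg[of T] by (simp add: add_nonneg_pos)
  define \<tau> where "\<tau> l = min (min (\<delta> l) 1) (\<eta> / K l)" for l
  have \<tau>: "\<tau> l > 0" "\<tau> l \<le> \<delta> l" "\<tau> l \<le> 1" for l
    using \<delta>[of l] \<eta>(1) Kpos[of l] by (auto simp: \<tau>_def)
  define V where "V = {v. \<exists>l t. 0 < t \<and> t \<le> \<tau> l \<and> solution T (W l) (C l) t v}"
  define X Y where "X v = (\<chi> i. contract T v $ i $ j0)" and "Y v = (\<chi> j. contract T v $ i0 $ j)" for v
  have V: "contract T v = outer2 (X v) (Y v)" "norm (X v - axis i0 1) \<le> \<eta>" "norm (Y v - axis j0 1) \<le> \<eta>"
    if vV: "v \<in> V" for v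
  proof -
    obtain l t where t: "0 < t" "t \<le> \<tau> l" and s: "solution T (W l) (C l) t v"
      using vV by (auto simp: V_def)
    show "contract T v = outer2 (X v) (Y v)"
      unfolding X_def Y_def by (rule solution_rank_one[OF T s])
    have "t \<le> \<eta> / K l" using t by (simp add: \<tau>_def)
    then have Kt: "K l * t \<le> \<eta>" using Kpos[of l] by (simp add: field_simps)
    have nn: "total T * C l * t \<ge> 0" using total_nonneg[of T] C[of l] t by simp
    then have nn': "real CARD('m) * (total T * C l * t) \<ge> 0" "real CARD('n) * (total T * C l * t) \<ge> 0"
      by simp_all
    have "K l * t = real CARD('m) * (total T * C l * t) + real CARD('n) * (total T * C l * t) + t"
      by (simp add: K_def algebra_simps)
    then have "real CARD('m) * (total T * (C l * t)) \<le> \<eta>" "real CARD('n) * (total T * (C l * t)) \<le> \<eta>"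
      using Kt nn' t(1) by (simp_all add: mult.assoc)
    moreover have "C l * t \<ge> 0" using C[of l] t by simp
    ultimately show "norm (X v - axis i0 1) \<le> \<eta>" "norm (Y v - axis j0 1) \<le> \<eta>"
      unfolding X_def Y_def using solution_near[OF T s] by linarith+
  qed
  \<comment> \<open>If h is orthogonal to all solutions, its pairing with \<open>approx\<close> is
    O(t^(N+1)), so the coefficients up to order N vanish and h lies in the kernel of the invertible
    matrix.\<close>
  have "span V = UNIV"
  proof (rule ccontr)
    assume "span V \<noteq> UNIV"
    then have "dim V < DIM(real^'q)"
      using dim_eq_full[of V] dim_subset_UNIV[of V] by linarith
    then obtain h where h: "h \<noteq> 0" "\<And>v. v \<in> span V \<Longrightarrow> orthogonal h v"
      using orthogonal_to_subspace_exists by blast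
    have "((\<chi> l l'. coeff (approx T (W l) N l') (d l)) *v h) $ l = 0" for l
    proof -
      define q where "q = (\<Sum>k\<in>UNIV. smult (h $ k) (approx T (W l) N k))"
      have bd: "\<bar>poly q t\<bar> \<le> ((\<Sum>k\<in>UNIV. \<bar>h $ k\<bar>) * C' l) * t ^ Suc N" if t: "0 < t" "t \<le> \<tau> l" for t
      proof -
        obtain v where s: "solution T (W l) (C l) t v" using ex t \<tau>(2)[of l] by force
        then have "v \<in> V" using t by (auto simp: V_def)
        then have "inner h v = 0" using h(2) span_base unfolding orthogonal_def by blast
        then have 0: "(\<Sum>k\<in>UNIV. h $ k * v $ k) = 0" by (simp add: inner_vec_def)
        have "poly q t = (\<Sum>k\<in>UNIV. h $ k * poly (approx T (W l) N k) t) - (\<Sum>k\<in>UNIV. h $ k * v $ k)"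
          by (simp add: q_def poly_sum 0)
        also have "\<dots> = (\<Sum>k\<in>UNIV. h $ k * (poly (approx T (W l) N k) t - v $ k))"
          by (simp add: right_diff_distrib sum_subtractf)
        also have "\<bar>\<dots>\<bar> \<le> (\<Sum>k\<in>UNIV. \<bar>h $ k * (poly (approx T (W l) N k) t - v $ k)\<bar>)" by (rule sum_abs)
        also have "\<dots> \<le> (\<Sum>k\<in>UNIV. \<bar>h $ k\<bar> * (C' l * t ^ Suc N))"
        proof (rule sum_mono)
          fix k
          have "\<bar>v $ k - poly (approx T (W l) N k) t\<bar> \<le> C' l * t ^ Suc N"
            using C'(2)[OF t(1) _ s] t \<tau>(3)[of l] by force
          then show "\<bar>h $ k * (poly (approx T (W l) N k) t - v $ k)\<bar> \<le> \<bar>h $ k\<bar> * (C' l * t ^ Suc N)"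
            unfolding abs_mult by (intro mult_left_mono) (auto simp: abs_minus_commute)
        qed
        also have "\<dots> = ((\<Sum>k\<in>UNIV. \<bar>h $ k\<bar>) * C' l) * t ^ Suc N"
          by (simp only: sum_distrib_right mult.assoc)
        finally show ?thesis .
      qed
      have "coeff q (d l) = 0"
        using coeff_eq_0_if_poly_le_power[OF \<tau>(1) bd] d[of l] by simp
      then show ?thesis by (simp add: matrix_vector_mult_def q_def coeff_sum mult.commute)
    qed
    then have "(\<chi> l l'. coeff (approx T (W l) N l') (d l)) *v h = 0" by (simp add: vec_eq_iff)
    with det h(1) show False unfolding det_nonzero_iff_ker by blast
  qed
  obtain B where B: "B \<subseteq> V" "independent B" "V \<subseteq> span B"
    using maximal_independent_subset by blast
  have "span B = UNIV" using \<open>span V = UNIV\<close> B(3) span_minimal[OF B(3) subspace_span] by auto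
  then have cB: "card B = CARD('q)"
    using dim_eq_card_independent[OF B(2)] dim_eq_full[of B] by simp
  have "finite B" using B(2) independent_imp_finite by blast
  then obtain g where g: "bij_betw g (UNIV :: 'q set) B"
    using finite_same_card_bij[of "UNIV :: 'q set" B] cB by auto
  \<comment> \<open>The rows are q independent solutions, so every slice of \<open>act3 R T\<close>
    is a rank-one matrix.\<close>
  define R :: "real^'q^'q" where "R = (\<chi> s. g s)"
  have "h = 0" if "R *v h = 0" for h
  proof -
      have "orthogonal h (g s)" for s
      proof -
        have "(R *v h) $ s = inner h (g s)" by (simp add: R_def matrix_vector_mult_def inner_vec_def mult.commute)
        then show ?thesis using that by (simp add: orthogonal_def)
      qed
      then have "\<And>b. b \<in> B \<Longrightarrow> orthogonal h b" using g by (metis bij_betw_def imageE)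
      then have "orthogonal h h" using orthogonal_to_span[of h B h] \<open>span B = UNIV\<close> by auto
      then show ?thesis by (simp add: orthogonal_def)
  qed
  then have "invertible R" using det_nonzero_iff_ker invertible_det_nz by blast
  then obtain R' where R': "R ** R' = mat 1" "R' ** R = mat 1" unfolding invertible_def by blast
  have gV: "g s \<in> V" for s using g B(1) by (auto simp: bij_betw_def)
  have "act3 R T \<in> interior {T. tensor_rank T \<le> CARD('q)}"
  proof (rule interior_rank_le_if_tangent)
    fix i j s
    have "act3 R T $ i $ j $ s = contract T (g s) $ i $ j"
      by (simp add: act3_def R_def matrix_vector_mult_def contract_def mult.commute)
    also have "\<dots> = X (g s) $ i * Y (g s) $ j"
      using V(1)[OF gV[of s]] by (simp add: outer2_def)
    finally show "act3 R T $ i $ j $ s = X (g s) $ i * Y (g s) $ j" .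
  next
    fix s and M :: "real^'n^'m"
    obtain \<delta>a \<delta>b v where M: "M = outer2 \<delta>a (Y (g s)) + outer2 (X (g s)) \<delta>b + contract T v"
      using \<eta>(2)[OF V(2)[OF gV[of s]] V(3)[OF gV[of s]]] by blast
    have "transpose R ** transpose R' = mat 1"
      using R' by (metis matrix_transpose_mul transpose_mat)
    then have "contract (act3 R T) (transpose R' *v v) = contract T v"
      unfolding contract_act3 matrix_vector_mul_assoc by simp
    then show "\<exists>\<delta>a \<delta>b v. M = outer2 \<delta>a (Y (g s)) + outer2 (X (g s)) \<delta>b + contract (act3 R T) v"
      using M by metis
  qed
  then have "act3 R' (act3 R T) \<in> closure (interior {T. tensor_rank T \<le> CARD('q)})"
    by (intro closure_interior_rank_act3[OF R'(2)]) (use closure_subset in blast)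
  then show ?thesis by (simp add: act3_act3 R' act3_id)
qed

end

section \<open>The monomial model curve\<close>

text \<open>On the monomial curve, entry \<open>(i, j)\<close> is
  \<open>t ^ (\<alpha> i + \<beta> j)\<close>, so the coordinate \<open>\<rho> i j\<close> of equal
  weight can stand in for it. Weights are distinct on \<open>K0\<close>, and N exceeds them
  all.\<close>

locale weighted_chart = chart \<kappa> i0 j0 l0
  for \<kappa> :: "'q::finite \<Rightarrow> 'm::finite \<times> 'n::finite" and i0 j0 l0 +
  fixes \<alpha> :: "'m \<Rightarrow> nat" and \<beta> :: "'n \<Rightarrow> nat" and \<rho> :: "'m \<Rightarrow> 'n \<Rightarrow> 'q" and K0 :: "'q set" and N :: nat
  assumes \<alpha>_0: "\<alpha> i = 0 \<longleftrightarrow> i = i0" and \<beta>_0: "\<beta> j = 0 \<longleftrightarrow> j = j0"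
    and \<rho>_\<kappa>: "\<rho> (fst (\<kappa> l)) (snd (\<kappa> l)) = l"
    and weight_\<rho>: "\<alpha> (fst (\<kappa> (\<rho> i j))) + \<beta> (snd (\<kappa> (\<rho> i j))) = \<alpha> i + \<beta> j"
    and l0_K0: "l0 \<in> K0" and core_K0: "core \<subseteq> K0"
    and inj_weight: "inj_on (\<lambda>l. \<alpha> (fst (\<kappa> l)) + \<beta> (snd (\<kappa> l))) K0"
    and weight_less: "\<alpha> (fst (\<kappa> l)) + \<beta> (snd (\<kappa> l)) < N"
begin

definition wt :: "'q \<Rightarrow> nat" where
  "wt l = \<alpha> (fst (\<kappa> l)) + \<beta> (snd (\<kappa> l))"

text \<open>The span of the slices of the tensor \<open>model\<close> contains \<open>x \<otimes> y\<close> for \<open>x\<^sub>i = t ^ \<alpha> i\<close>,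
  \<open>y\<^sub>j = t ^ \<beta> j\<close>; the coordinates \<open>\<kappa> l\<close>, \<open>l \<notin> K0\<close>, can moreover be moved independently, which
  the perturbation of order \<open>N\<close> in \<open>mcurve\<close> detects.\<close>

definition model :: "real^'q^'n^'m" where
  "model = (\<chi> i j l. of_bool (l = \<rho> i j))"

definition mcurve :: "'q \<Rightarrow> 'q \<Rightarrow> real poly" where
  "mcurve l l' = monom 1 (wt l') + (if l \<notin> K0 \<and> l' = l then monom 1 N else 0)"

text \<open>The order of the coefficient read in row l: weights separate the coordinates in
  \<open>K0\<close>, while order N sees only the added perturbation.\<close>

definition probe :: "'q \<Rightarrow> nat" where
  "probe l = (if l \<in> K0 then wt l else N)"

lemma wt_\<rho>: "wt (\<rho> i j) = \<alpha> i + \<beta> j"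
  by (simp add: wt_def weight_\<rho>)

lemma wt_less: "wt l < N"
  by (simp add: wt_def weight_less)

lemma wt_eq_0: "wt l = 0 \<longleftrightarrow> l = l0"
proof
  assume "wt l = 0"
  then have "fst (\<kappa> l) = i0" "snd (\<kappa> l) = j0" by (auto simp: wt_def \<alpha>_0 \<beta>_0)
  then show "l = l0" using \<rho>_\<kappa>[of l] \<rho>_\<kappa>[of l0] \<kappa>_l0 by simp
qed (simp add: wt_def \<kappa>_l0 \<alpha>_0 \<beta>_0)

lemma \<rho>_eq_l0: "\<rho> i j = l0 \<longleftrightarrow> i = i0 \<and> j = j0"
  using wt_eq_0[of "\<rho> i j"] by (simp add: wt_\<rho> \<alpha>_0 \<beta>_0)

lemma normal_model: "normal model"
  unfolding normal_def model_def by (auto simp: \<rho>_\<kappa>) (metis \<rho>_eq_l0)+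

lemma curve_mcurve: "curve (mcurve l)"
proof -
  have "wt l0 = 0" using wt_eq_0 by blast
  then have "mcurve l l0 = 1" using l0_K0 by (auto simp: mcurve_def one_pCons monom_0)
  moreover have "coeff (mcurve l k) 0 = 0" if "k \<noteq> l0" for k
    using wt_less[of l0] that by (auto simp: mcurve_def coeff_monom wt_eq_0)
  ultimately show ?thesis unfolding curve_def by blast
qed

lemma coeff_mcurve:
  "coeff (mcurve l l') d = of_bool (d = wt l') + of_bool (l \<notin> K0 \<and> l' = l \<and> d = N)"
  by (auto simp: mcurve_def coeff_monom)

text \<open>The monomial curve is an exact fixed point since weights add. The perturbation of order
  N enters a product together with a factor vanishing at t = 0, so it changes core values only
  beyond order N.\<close>

lemma coeff_approx_model:
  assumes "d \<le> n" and "d \<le> N"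
  shows "coeff (approx model (mcurve l) n k) d = coeff (mcurve l k) d"
  using assms
proof (induction n arbitrary: k d)
  case 0
  then show ?case using wt_eq_0[of k] wt_less[of k] core_K0 \<kappa>_l0 l0_K0
    by (auto simp: coeff_mcurve core_def)
next
  case (Suc n)
  show ?case
  proof (cases "k \<in> core")
    case True
    \<comment> \<open>The only slices of \<open>model\<close> that are nonzero at the two positions
      entering \<open>step\<close>; their weights add up to that of k.\<close>
    define a b where "a = \<rho> (fst (\<kappa> k)) j0" and "b = \<rho> i0 (snd (\<kappa> k))"
    have a0: "wt a \<noteq> 0" and b0: "wt b \<noteq> 0"
      using True by (auto simp: a_def b_def wt_\<rho> core_def \<alpha>_0 \<beta>_0)
    have ab: "wt a + wt b = wt k"
      unfolding a_def b_def wt_\<rho> by (simp add: wt_def \<alpha>_0[THEN iffD2] \<beta>_0[THEN iffD2])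
    let ?V = "approx model (mcurve l) n"
    have pick: "(\<Sum>k\<in>UNIV. [:model $ i $ j $ k:] * ?V k) = ?V (\<rho> i j)" for i j
    proof -
      have "(\<Sum>k\<in>UNIV. [:model $ i $ j $ k:] * ?V k) = (\<Sum>k\<in>UNIV. if k = \<rho> i j then ?V k else 0)"
        by (rule sum.cong) (auto simp: model_def)
      then show ?thesis by simp
    qed
    have "coeff (approx model (mcurve l) (Suc n) k) d = (\<Sum>i\<le>d. coeff (?V a) i * coeff (?V b) (d - i))"
      using True by (simp add: step_def pick coeff_mult a_def b_def del: mult_pCons_left)
    also have "\<dots> = (\<Sum>i\<le>d. of_bool (i = wt a \<and> d - i = wt b))"
    proof (rule sum.cong[OF refl])
      fix i assume i: "i \<in> {..d}"
      have z: "coeff (?V k') 0 = of_bool (wt k' = 0)" for k'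
        using Suc.IH[of 0 k'] wt_less[of k'] by (auto simp: coeff_mcurve)
      \<comment> \<open>At both ends a constant coefficient occurs, which vanishes as a and b have
        positive weight. In between, both orders are at most n and differ from N.\<close>
      consider "i = 0" | "i = d" | "0 < i" "i < d" using i by fastforce
      then show "coeff (?V a) i * coeff (?V b) (d - i) = of_bool (i = wt a \<and> d - i = wt b)"
      proof cases
        case 3
        then have "coeff (?V a) i = coeff (mcurve l a) i"
          "coeff (?V b) (d - i) = coeff (mcurve l b) (d - i)"
          using Suc.IH Suc.prems by auto
        moreover have "i \<noteq> N" "d - i \<noteq> N" using 3 Suc.prems by auto
        ultimately show ?thesis by (auto simp: coeff_mcurve)
      qed (use z a0 b0 in auto)
    qed
    also have "\<dots> = (\<Sum>i\<le>d. if i = wt a then of_bool (d - wt a = wt b) else 0)"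
      by (rule sum.cong) auto
    also have "\<dots> = of_bool (d = wt k)" using ab b0 by (auto simp: of_bool_def)
    also have "\<dots> = coeff (mcurve l k) d" using True core_K0 by (auto simp: coeff_mcurve)
    finally show ?thesis .
  next
    case False
    then show ?thesis by (simp add: step_def)
  qed
qed

text \<open>Rows outside \<open>K0\<close> are unit vectors, and distinct weights make the block on
  \<open>K0\<close> the identity.\<close>

lemma det_model: "det (\<chi> l l'. coeff (approx model (mcurve l) N l') (probe l)) \<noteq> 0"
proof -
  let ?A = "(\<chi> l l'. coeff (approx model (mcurve l) N l') (probe l)) :: real^'q^'q"
  have A: "?A $ l $ l' = (if l \<in> K0 then of_bool (wt l = wt l') else of_bool (l = l'))" for l l'
  proof -
    have "probe l \<le> N" using wt_less[of l] by (simp add: probe_def)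
    then show ?thesis
      using wt_less[of l] wt_less[of l'] by (auto simp: coeff_approx_model coeff_mcurve probe_def)
  qed
  have "v = 0" if v: "?A *v v = 0" for v
  proof -
    have row: "(\<Sum>l'\<in>UNIV. ?A $ l $ l' * v $ l') = 0" for l
      using arg_cong[OF v, of "\<lambda>z. z $ l"] by (simp add: matrix_vector_mult_def)
    have out: "v $ l = 0" if "l \<notin> K0" for l
    proof -
      have "(\<Sum>l'\<in>UNIV. ?A $ l $ l' * v $ l') = (\<Sum>l'\<in>UNIV. if l' = l then v $ l else 0)"
        unfolding A by (rule sum.cong) (use that in auto)
      then show ?thesis using row by simp
    qed
    have "v $ l = 0" if "l \<in> K0" for l
    proof -
      have "?A $ l $ l' * v $ l' = (if l' = l then v $ l else 0)" for l'
        unfolding A using that out[of l'] inj_onD[OF inj_weight, of l l'] by (auto simp: wt_def)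
      then have "(\<Sum>l'\<in>UNIV. ?A $ l $ l' * v $ l') = (\<Sum>l'\<in>UNIV. if l' = l then v $ l else 0)"
        by (intro sum.cong) auto
      then show ?thesis using row by simp
    qed
    with out show ?thesis by (auto simp: vec_eq_iff)
  qed
  then show ?thesis unfolding det_nonzero_iff_ker by blast
qed

text \<open>Normal tensors form an affine space, so the line from T to \<open>model\<close> stays
  normal, and the determinant criterion fails at only finitely many of its points.\<close>

lemma closure_interior_rank_normal:
  assumes T: "normal T"
  shows "T \<in> closure (interior {T. tensor_rank T \<le> CARD('q)})"
proof -
  let ?\<phi> = "\<lambda>T. det (\<chi> l l'. coeff (approx T (mcurve l) N l') (probe l)) :: real"
  have "real_polynomial_function ?\<phi>"
    by (rule real_polynomial_function_det) (simp add: real_polynomial_function_coeff_approx)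
  from finite_zeros_on_line[where A = T, OF this det_model]
  have fin: "finite {s. ?\<phi> (T + s *\<^sub>R (model - T)) = 0}" .
  have "T + s *\<^sub>R (model - T) \<in> closure (interior {T. tensor_rank T \<le> CARD('q)})"
    if "?\<phi> (T + s *\<^sub>R (model - T)) \<noteq> 0" for s
  proof (rule closure_interior_rank_if_det[OF _ curve_mcurve _ that])
    show "normal (T + s *\<^sub>R (model - T))"
      using T normal_model unfolding normal_def by (simp add: algebra_simps)
    show "probe l \<le> N" for l using wt_less[of l] by (simp add: probe_def)
  qed
  then have "finite {s. T + s *\<^sub>R (model - T) \<notin> closure (interior {T. tensor_rank T \<le> CARD('q)})}"
    by (intro finite_subset[OF _ fin]) blast
  from closure_from_cofinite_line[OF this] show ?thesis by simp
qed

end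

section \<open>Normal form\<close>

text \<open>The (m - 1) (n - 1) core positions, \<open>(i0, j0)\<close> of weight 0 and one more
  position of weight 1 have as weights an interval that contains the weights of all entries. This is
  where the lower bound on q comes from.\<close>

lemma weighted_chart_exists:
  assumes m: "CARD('m::finite) \<ge> 2" and n: "CARD('n::finite) \<ge> 2"
    and q: "(CARD('m) - 1) * (CARD('n) - 1) + 2 \<le> CARD('q::finite)" "CARD('q) \<le> CARD('m) * CARD('n)"
  shows "\<exists>(\<kappa> :: 'q \<Rightarrow> 'm \<times> 'n) i0 j0 l0 \<alpha> \<beta> \<rho> K0 N. weighted_chart \<kappa> i0 j0 l0 \<alpha> \<beta> \<rho> K0 N"
proof -
  define m' n' where "m' = CARD('m) - 1" and "n' = CARD('n) - 1"
  have m': "CARD('m) = Suc m'" "m' \<ge> 1" and n': "CARD('n) = Suc n'" "n' \<ge> 1"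
    using m n by (auto simp: m'_def n'_def)
  obtain \<alpha> where \<alpha>: "bij_betw \<alpha> (UNIV :: 'm set) {..m'}"
    using finite_same_card_bij[of "UNIV :: 'm set" "{..m'}"] m' by auto
  obtain \<gamma> where \<gamma>: "bij_betw \<gamma> (UNIV :: 'n set) {..n'}"
    using finite_same_card_bij[of "UNIV :: 'n set" "{..n'}"] n' by auto
  obtain i0 i1 where i0: "\<alpha> i0 = 0" and i1: "\<alpha> i1 = 1"
    using \<alpha> m' by (metis atMost_iff bij_betw_iff_bijections zero_le)
  obtain j0 where j0: "\<gamma> j0 = 0"
    using \<gamma> by (metis atMost_iff bij_betw_iff_bijections zero_le)
  have \<alpha>_inj: "\<alpha> i = \<alpha> i' \<longleftrightarrow> i = i'" and \<gamma>_inj: "\<gamma> j = \<gamma> j' \<longleftrightarrow> j = j'" for i i' j j'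
    using \<alpha> \<gamma> by (auto simp: bij_betw_def inj_on_def)
  have \<alpha>_le: "\<alpha> i \<le> m'" and \<gamma>_le: "\<gamma> j \<le> n'" for i j
    using \<alpha> \<gamma> by (auto simp: bij_betw_def)
  have \<alpha>0: "\<alpha> i = 0 \<longleftrightarrow> i = i0" and \<gamma>0: "\<gamma> j = 0 \<longleftrightarrow> j = j0" for i j
    using \<alpha>_inj[of i i0] \<gamma>_inj[of j j0] i0 j0 by auto
  \<comment> \<open>By division with remainder by \<open>m'\<close>, the sums \<open>\<alpha> i + \<beta> j\<close> with \<open>i \<noteq> i0\<close>, \<open>j \<noteq> j0\<close> take each
    value in \<open>{2..m' * n' + 1}\<close> exactly once.\<close>
  define \<beta> where "\<beta> j = (if \<gamma> j = 0 then 0 else 1 + (\<gamma> j - 1) * m')" for j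
  define w where "w z = \<alpha> (fst z) + \<beta> (snd z)" for z
  define C where "C = (UNIV - {i0}) \<times> (UNIV - {j0})"
  define K0 where "K0 = insert (i0, j0) (insert (i1, j0) C)"
  have i10: "i1 \<noteq> i0" using i0 i1 by auto
  have card_K0: "card K0 = m' * n' + 2"
    using i10 m' n' by (simp add: K0_def C_def card_cartesian_product card_Diff_singleton)
  have wC: "w z = \<alpha> (fst z) + 1 + (\<gamma> (snd z) - 1) * m'" "1 \<le> \<alpha> (fst z)" "1 \<le> \<gamma> (snd z)" if "z \<in> C" for z
    using that \<alpha>0[of "fst z"] \<gamma>0[of "snd z"] by (auto simp: C_def w_def \<beta>_def)
  have wC_le: "w z \<le> m' * n' + 1" "2 \<le> w z" if "z \<in> C" for z
  proof -
    have "\<alpha> (fst z) + (\<gamma> (snd z) - 1) * m' \<le> m' + (n' - 1) * m'"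
      using \<alpha>_le \<gamma>_le by (intro add_mono mult_right_mono diff_le_mono) auto
    also have "\<dots> = m' * n'" using n' by (cases n') (auto simp: algebra_simps)
    finally show "w z \<le> m' * n' + 1" using wC[OF that] by simp
    show "2 \<le> w z" using wC[OF that] by simp
  qed
  have w0: "w (i0, j0) = 0" "w (i1, j0) = 1" by (simp_all add: w_def i0 i1 j0 \<beta>_def)
  have w_inj_C: "inj_on w C"
  proof (rule inj_onI)
    fix z z' assume z: "z \<in> C" "z' \<in> C" "w z = w z'"
    define a b a' b' where ab: "a = \<alpha> (fst z) - 1" "b = \<gamma> (snd z) - 1" "a' = \<alpha> (fst z') - 1" "b' = \<gamma> (snd z') - 1"
    have lt: "a < m'" "a' < m'" using \<alpha>_le[of "fst z"] \<alpha>_le[of "fst z'"] m' wC[OF z(1)] wC[OF z(2)] by (auto simp: ab)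
    have "a + b * m' = a' + b' * m'" using z(3) wC[OF z(1)] wC[OF z(2)] by (simp add: ab)
    then have "(a + b * m') mod m' = (a' + b' * m') mod m'" "(a + b * m') div m' = (a' + b' * m') div m'" by simp_all
    then have "a = a'" "b = b'" using lt by simp_all
    then have "\<alpha> (fst z) = \<alpha> (fst z')" "\<gamma> (snd z) = \<gamma> (snd z')"
      using wC[OF z(1)] wC[OF z(2)] by (auto simp: ab)
    then show "z = z'" by (simp add: \<alpha>_inj \<gamma>_inj prod_eq_iff)
  qed
  have w_inj: "inj_on w K0"
    unfolding K0_def using w_inj_C wC_le w0 by (force simp: inj_on_insert)
  have "w ` K0 = {..m' * n' + 1}"
  proof (rule card_subset_eq)
    show "w ` K0 \<subseteq> {..m' * n' + 1}" using wC_le w0 by (auto simp: K0_def)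
    show "card (w ` K0) = card {..m' * n' + 1}" using card_image[OF w_inj] card_K0 by simp
  qed simp
  moreover have w_le: "w z \<le> m' * n' + 1" for z
  proof (cases "z \<in> C")
    case False
    then consider "fst z = i0" | "snd z = j0" by (cases z) (auto simp: C_def)
    then show ?thesis
    proof cases
      case 1
      have "(\<gamma> (snd z) - 1) * m' \<le> n' * m'" using \<gamma>_le[of "snd z"] by (intro mult_right_mono) auto
      then show ?thesis using 1 by (simp add: w_def i0 \<beta>_def mult.commute)
    next
      case 2
      have "\<alpha> (fst z) \<le> m' * n'" using \<alpha>_le[of "fst z"] n' by (metis One_nat_def le_trans mult.right_neutral mult_le_mono2)
      then show ?thesis using 2 by (simp add: w_def j0 \<beta>_def)
    qed
  qed (use wC_le in auto)
  ultimately have w_ex: "\<exists>z'\<in>K0. w z' = w z" for z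
    by (metis (no_types, lifting) atMost_iff imageE)
  \<comment> \<open>Any q positions containing \<open>K0\<close> will do: \<open>\<rho>\<close>
    fixes the positions in K and sends the others to one of equal weight.\<close>
  obtain K where K: "K0 \<subseteq> K" "card K = CARD('q)"
    using exists_subset_between[of K0 "CARD('q)" UNIV] q card_K0
    by (auto simp: m'_def n'_def)
  obtain \<kappa> where \<kappa>: "bij_betw \<kappa> (UNIV :: 'q set) K"
    using finite_same_card_bij[of "UNIV :: 'q set" K] K(2) by auto
  have \<kappa>_inj: "\<kappa> l = \<kappa> l' \<longleftrightarrow> l = l'" for l l'
    using \<kappa> by (auto simp: bij_betw_def inj_on_def)
  have \<kappa>_ex: "\<exists>l. \<kappa> l = z" if "z \<in> K" for z
    using \<kappa> that by (metis bij_betw_iff_bijections)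
  have "\<exists>l. (z \<in> K \<longrightarrow> \<kappa> l = z) \<and> w (\<kappa> l) = w z" for z
    using \<kappa>_ex[of z] w_ex[of z] \<kappa>_ex K(1) by (cases "z \<in> K") (metis subsetD)+
  then obtain \<rho> where \<rho>: "\<And>z. z \<in> K \<Longrightarrow> \<kappa> (\<rho> z) = z" "\<And>z. w (\<kappa> (\<rho> z)) = w z" by metis
  obtain l0 where l0: "\<kappa> l0 = (i0, j0)" using \<kappa>_ex[of "(i0,j0)"] K(1) by (auto simp: K0_def)
  have \<kappa>K: "\<kappa> l \<in> K" for l using \<kappa> by (auto simp: bij_betw_def)
  have chart: "chart \<kappa> i0 j0 l0"
  proof
    fix i j assume "i \<noteq> i0" "j \<noteq> j0"
    then have "(i, j) \<in> K" using K(1) by (auto simp: K0_def C_def)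
    then show "\<exists>l. \<kappa> l = (i, j)" by (rule \<kappa>_ex)
  qed (rule l0)
  have "weighted_chart \<kappa> i0 j0 l0 \<alpha> \<beta> (\<lambda>i j. \<rho> (i, j)) (\<kappa> -` K0) (m' * n' + 2)"
  proof (intro weighted_chart.intro weighted_chart_axioms.intro chart)
    show "\<beta> j = 0 \<longleftrightarrow> j = j0" for j using \<gamma>0[of j] by (simp add: \<beta>_def)
    show "\<rho> (fst (\<kappa> l), snd (\<kappa> l)) = l" for l
      using \<rho>(1)[OF \<kappa>K[of l]] \<kappa>_inj by simp
    show "\<alpha> (fst (\<kappa> (\<rho> (i, j)))) + \<beta> (snd (\<kappa> (\<rho> (i, j)))) = \<alpha> i + \<beta> j" for i j
      using \<rho>(2)[of "(i, j)"] by (simp add: w_def)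
    show "l0 \<in> \<kappa> -` K0" by (simp add: l0 K0_def)
    show "chart.core \<kappa> i0 j0 \<subseteq> \<kappa> -` K0"
      by (auto simp: chart.core_def[OF chart] K0_def C_def mem_Times_iff)
    show "inj_on (\<lambda>l. \<alpha> (fst (\<kappa> l)) + \<beta> (snd (\<kappa> l))) (\<kappa> -` K0)"
      using w_inj \<kappa>_inj unfolding inj_on_def w_def by blast
    show "\<alpha> (fst (\<kappa> l)) + \<beta> (snd (\<kappa> l)) < m' * n' + 2" for l
      using w_le[of "\<kappa> l"] by (simp add: w_def)
  qed (rule \<alpha>0)
  then show ?thesis by blast
qed

section \<open>Change of basis to normal form\<close>

lemma contract_axis: "contract T (axis l 1) $ i $ j = T $ i $ j $ l"
proof -
  have "(\<Sum>k\<in>UNIV. T $ i $ j $ k * axis l 1 $ k) = (\<Sum>k\<in>UNIV. if k = l then T $ i $ j $ l else 0)"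
    by (rule sum.cong) (auto simp: axis_def)
  then show ?thesis by (simp add: contract_def)
qed

definition coord_matrix :: "('q \<Rightarrow> 'm \<times> 'n) \<Rightarrow> real^'q^'n^'m \<Rightarrow> real^'q^'q" where
  "coord_matrix \<kappa> T = (\<chi> l' l. T $ fst (\<kappa> l') $ snd (\<kappa> l') $ l)"

lemma coord_matrix_mult: "(coord_matrix \<kappa> T *v v) $ l = contract T v $ fst (\<kappa> l) $ snd (\<kappa> l)"
  by (simp add: coord_matrix_def contract_def matrix_vector_mult_def)

lemma real_polynomial_function_det_coord_matrix:
  "real_polynomial_function (\<lambda>T. det (coord_matrix \<kappa> T))"
  by (rule real_polynomial_function_det) (simp add: coord_matrix_def real_polynomial_function_entry)

lemma contract_add_scale:
  "contract (A + s *\<^sub>R (B - A)) v = contract A v + s *\<^sub>R (contract B v - contract A v)"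
  by (simp add: contract_def vec_eq_iff algebra_simps sum.distrib sum_subtractf sum_distrib_left)

lemma orthogonal_transpose_basis:
  fixes x :: "real^'m"
  assumes "norm x = 1"
  obtains P :: "real^'m^'m" where "P ** transpose P = mat 1" "transpose P ** P = mat 1"
    "transpose P *v x = axis i 1"
proof -
  obtain P where P: "orthogonal_matrix P" "P *v axis i 1 = x"
    using orthogonal_matrix_exists_basis[OF assms] by metis
  then have "P ** transpose P = mat 1" "transpose P ** P = mat 1"
    unfolding orthogonal_matrix_def by auto
  moreover from this have "transpose P *v x = axis i 1"
    unfolding P(2)[symmetric] matrix_vector_mul_assoc by simp
  ultimately show ?thesis using that by blast
qed

text \<open>Orthogonal changes move the rank-one matrix to the base position. A line that keeps it
  in the span leads to a tensor with invertible coordinate matrix, so nearly all points of the line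
  can be brought to normal form.\<close>

lemma closure_interior_rank_if_rank_one:
  fixes T :: "real^'q^'n^'m"
  assumes sizes: "CARD('m) \<ge> 2" "CARD('n) \<ge> 2"
    "(CARD('m) - 1) * (CARD('n) - 1) + 2 \<le> CARD('q)" "CARD('q) \<le> CARD('m) * CARD('n)"
    and T: "contract T c0 = outer2 x0 y0" "x0 \<noteq> 0" "y0 \<noteq> 0"
  shows "T \<in> closure (interior {T. tensor_rank T \<le> CARD('q)})"
proof -
  obtain \<kappa> :: "'q \<Rightarrow> 'm \<times> 'n" and i0 j0 l0 \<alpha> \<beta> \<rho> K0 N
    where "weighted_chart \<kappa> i0 j0 l0 \<alpha> \<beta> \<rho> K0 N"
    using weighted_chart_exists[OF sizes] by blast
  then interpret weighted_chart \<kappa> i0 j0 l0 \<alpha> \<beta> \<rho> K0 N .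
  define c where "c = (1 / (norm x0 * norm y0)) *\<^sub>R c0"
  define x y where "x = (1 / norm x0) *\<^sub>R x0" and "y = (1 / norm y0) *\<^sub>R y0"
  have xy: "norm x = 1" "norm y = 1" using T by (auto simp: x_def y_def)
  have c: "contract T c = outer2 x y"
    by (simp add: c_def x_def y_def linear_scale[OF linear_contract] T(1)) (simp add: outer2_def vec_eq_iff)
  obtain P where P: "P ** transpose P = mat 1" "transpose P ** P = mat 1" "transpose P *v x = axis i0 1"
    using orthogonal_transpose_basis[OF xy(1)] by blast
  obtain Q where Q: "Q ** transpose Q = mat 1" "transpose Q ** Q = mat 1" "transpose Q *v y = axis j0 1"
    using orthogonal_transpose_basis[OF xy(2)] by blast
  define E :: "real^'n^'m" where "E = outer2 (axis i0 1) (axis j0 1)"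
  have E: "E $ i $ j = of_bool (i = i0 \<and> j = j0)" for i j by (auto simp: E_def outer2_def axis_def)
  define T1 where "T1 = act12 (transpose P) (transpose Q) T"
  have T1: "contract T1 c = E"
    unfolding T1_def contract_act12_outer2[OF c] P Q E_def ..
  have "E \<noteq> 0" using E[of i0 j0] by auto
  then have c0: "c \<noteq> 0" using T1 linear_0[OF linear_contract] by metis
  have "norm ((1 / norm c) *\<^sub>R c) = 1" using c0 by simp
  then obtain O' where O: "O' ** transpose O' = mat 1" "transpose O' ** O' = mat 1"
    "transpose O' *v ((1 / norm c) *\<^sub>R c) = axis l0 1"
    using orthogonal_transpose_basis by blast
  \<comment> \<open>The orthogonal matrix turns c into the direction \<open>l0\<close>; the scalar
    corrects the length.\<close>
  define D where "D = (1 / norm c) *\<^sub>R transpose O'"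
  have Dc: "D *v c = axis l0 1"
    using O(3) by (simp only: D_def scaleR_matrix_vector_assoc[symmetric] matrix_vector_mult_scaleR)
  have D0: "h = 0" if "D *v h = 0" for h
  proof -
    have "transpose O' *v h = 0"
      using that c0 by (simp only: D_def scaleR_matrix_vector_assoc[symmetric]) simp
    then have "(O' ** transpose O') *v h = 0"
      unfolding matrix_vector_mul_assoc[symmetric] by (simp only: matrix_vector_mult_0_right)
    then show ?thesis by (simp add: O(1))
  qed
  \<comment> \<open>Has D as coordinate matrix and zeros elsewhere, so it contracts with c to E just
    as \<open>T1\<close> does.\<close>
  define T0 :: "real^'q^'n^'m" where
    "T0 = (\<chi> i j l. if (i, j) \<in> range \<kappa> then D $ \<rho> i j $ l else 0)"
  have "coord_matrix \<kappa> T0 = D"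
    by (simp add: coord_matrix_def T0_def vec_eq_iff \<rho>_\<kappa>)
  then have det0: "det (coord_matrix \<kappa> T0) \<noteq> 0" using D0 det_nonzero_iff_ker by blast
  have T0: "contract T0 c = E"
  proof -
    have "contract T0 c $ i $ j = E $ i $ j" for i j
    proof (cases "(i, j) \<in> range \<kappa>")
      case True
      then have "contract T0 c $ i $ j = (D *v c) $ \<rho> i j"
        by (simp add: contract_def T0_def matrix_vector_mult_def)
      then show ?thesis by (simp add: Dc E axis_def \<rho>_eq_l0 eq_commute[of l0])
    next
      case False
      then have "\<not> (i = i0 \<and> j = j0)" using \<kappa>_l0 by (metis rangeI)
      then show ?thesis using False by (simp add: E contract_def T0_def)
    qed
    then show ?thesis by (simp add: vec_eq_iff)
  qed
  let ?L = "\<lambda>s. T1 + s *\<^sub>R (T0 - T1)"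
  have "?L s \<in> closure (interior {T. tensor_rank T \<le> CARD('q)})" if s: "det (coord_matrix \<kappa> (?L s)) \<noteq> 0" for s
  proof -
    define R where "R = coord_matrix \<kappa> (?L s)"
    obtain R' where R': "R ** R' = mat 1" "R' ** R = mat 1"
      using s unfolding R_def invertible_det_nz[symmetric] invertible_def by blast
    have Lc: "contract (?L s) c = E" by (simp add: contract_add_scale T0 T1)
    have "R *v c = axis l0 1"
    proof -
      have "(R *v c) $ l = axis l0 1 $ l" for l
      proof -
        have "fst (\<kappa> l) = i0 \<and> snd (\<kappa> l) = j0 \<longleftrightarrow> l = l0"
          using \<rho>_\<kappa>[of l] \<rho>_eq_l0 by metis
        then show ?thesis by (simp add: R_def coord_matrix_mult Lc E axis_def eq_commute[of l0])
      qed
      then show ?thesis by (simp add: vec_eq_iff)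
    qed
    then have R'l0: "R' *v axis l0 1 = c"
      by (metis R'(2) matrix_vector_mul_assoc matrix_vector_mul_lid)
    \<comment> \<open>Recombines the slices by the inverse coordinate matrix; slice
      \<open>l0\<close> becomes the contraction with c, which is E.\<close>
    define T3 where "T3 = act3 (transpose R') (?L s)"
    have T3: "contract T3 v = contract (?L s) (R' *v v)" for v
      unfolding T3_def contract_act3 transpose_transpose ..
    have "normal T3"
      unfolding normal_def
    proof (intro conjI allI)
      fix l l'
      have "T3 $ fst (\<kappa> l') $ snd (\<kappa> l') $ l = (R *v (R' *v axis l 1)) $ l'"
        by (simp only: contract_axis[symmetric] T3 R_def coord_matrix_mult)
      then show "T3 $ fst (\<kappa> l') $ snd (\<kappa> l') $ l = of_bool (l = l')"
        by (simp add: matrix_vector_mul_assoc R' axis_def)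
    next
      fix i j
      show "T3 $ i $ j $ l0 = of_bool (i = i0 \<and> j = j0)"
        by (simp only: contract_axis[symmetric] T3 R'l0 Lc E)
    qed
    then have T3cl: "T3 \<in> closure (interior {T. tensor_rank T \<le> CARD('q)})"
      by (rule closure_interior_rank_normal)
    have tr: "transpose R ** transpose R' = mat 1" "transpose R' ** transpose R = mat 1"
      using R' by (metis matrix_transpose_mul transpose_mat)+
    have "act3 (transpose R) T3 = ?L s"
      by (simp add: T3_def act3_act3 tr act3_id)
    with closure_interior_rank_act3[OF tr(1) T3cl] show ?thesis by simp
  qed
  then have "finite {s. ?L s \<notin> closure (interior {T. tensor_rank T \<le> CARD('q)})}"
    by (intro finite_subset[OF _ finite_zeros_on_line[OF real_polynomial_function_det_coord_matrix det0, of T1]]) blast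
  from closure_from_cofinite_line[OF this]
  have "T1 \<in> closure (interior {T. tensor_rank T \<le> CARD('q)})" by simp
  from closure_interior_rank_act12[OF P(1) Q(1) this]
  show ?thesis by (simp add: T1_def act12_act12 P Q act12_id)
qed

text \<open>A rank-one slice is appended at index \<open>None\<close>, so the previous lemma applies
  with p + 1 slices; deleting that slice again does not raise the rank.\<close>

lemma closure_interior_rank_le_Suc:
  fixes T :: "real^'p^'n^'m"
  assumes sizes: "CARD('m) \<ge> 2" "CARD('n) \<ge> 2"
    "(CARD('m) - 1) * (CARD('n) - 1) + 1 \<le> CARD('p)" "CARD('p) < CARD('m) * CARD('n)"
  shows "T \<in> closure (interior {T. tensor_rank T \<le> Suc CARD('p)})"
proof -
  define i0 :: 'm and j0 :: 'n where "i0 = undefined" and "j0 = undefined"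
  define E :: "real^'n^'m" where "E = outer2 (axis i0 1) (axis j0 1)"
  define T' :: "real^('p option)^'n^'m" where
    "T' = (\<chi> i j l. case l of None \<Rightarrow> E $ i $ j | Some k \<Rightarrow> T $ i $ j $ k)"
  define \<pi> :: "real^('p option)^'n^'m \<Rightarrow> real^'p^'n^'m" where
    "\<pi> S = (\<chi> i j k. S $ i $ j $ Some k)" for S
  have card: "CARD('p option) = Suc CARD('p)" by simp
  have "contract T' (axis None 1) = E"
    by (simp add: vec_eq_iff contract_axis) (simp add: T'_def)
  then have cT': "contract T' (axis None 1) = outer2 (axis i0 1) (axis j0 1)" unfolding E_def .
  have T': "T' \<in> closure (interior {T. tensor_rank T \<le> CARD('p option)})"
    by (rule closure_interior_rank_if_rank_one[OF sizes(1,2) _ _ cT'])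
       (use sizes in \<open>simp_all add: axis_eq_0_iff\<close>)
  have lin: "linear \<pi>" by (rule linearI) (simp_all add: \<pi>_def vec_eq_iff)
  have surj: "surj \<pi>"
    by (rule surjI[of _ "\<lambda>S. \<chi> i j l. case l of None \<Rightarrow> 0 | Some k \<Rightarrow> S $ i $ j $ k"])
       (simp add: \<pi>_def vec_eq_iff)
  have "\<pi> (outer3 a b c) = outer3 a b (\<chi> k. c $ Some k)" for a b c
    by (simp add: \<pi>_def outer3_def vec_eq_iff)
  then have "\<exists>a' b' c'. \<pi> (outer3 a b c) = outer3 a' b' c'" for a b c by blast
  from closure_interior_rank_image[OF lin surj this T']
  have "\<pi> T' \<in> closure (interior {T. tensor_rank T \<le> CARD('p option)})" .
  moreover have "\<pi> T' = T" by (simp add: \<pi>_def T'_def vec_eq_iff)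
  ultimately show ?thesis by (simp only: card)
qed

section \<open>Typical ranks\<close>

text \<open>With fewer than p terms, some nonzero v is orthogonal to all third factors and contracts
  T to 0.\<close>

lemma tensor_rank_ge_if_contract_inj:
  fixes T :: "real^'p^'n^'m"
  assumes "\<And>v. contract T v = 0 \<Longrightarrow> v = 0"
  shows "CARD('p) \<le> tensor_rank T"
proof (rule ccontr)
  assume less: "\<not> CARD('p) \<le> tensor_rank T"
  obtain a b c where T: "T = (\<Sum>s<tensor_rank T. outer3 (a s) (b s) (c s))"
    by (rule tensor_rank_decomp)
  obtain v where v: "v \<noteq> 0" "\<And>s. s < tensor_rank T \<Longrightarrow> inner (c s) v = 0"
    using exists_orthogonal_to_few[of "tensor_rank T" c] less by auto
  have "contract T v = (\<Sum>s<tensor_rank T. inner (c s) v *\<^sub>R outer2 (a s) (b s))"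
    by (subst T) (rule contract_sum_outer3)
  also have "\<dots> = 0" using v(2) by simp
  finally show False using assms v(1) by blast
qed

lemma generic_rank_ge_third_dim:
  assumes "inj (\<kappa> :: 'p \<Rightarrow> 'm \<times> 'n)"
  shows "open {T :: real^'p^'n^'m. det (coord_matrix \<kappa> T) \<noteq> 0}"
    and "closure {T :: real^'p^'n^'m. det (coord_matrix \<kappa> T) \<noteq> 0} = UNIV"
    and "det (coord_matrix \<kappa> T) \<noteq> 0 \<Longrightarrow> CARD('p) \<le> tensor_rank T"
proof -
  define B :: "real^'p^'n^'m" where "B = (\<chi> i j l. of_bool (\<kappa> l = (i, j)))"
  have "coord_matrix \<kappa> B = mat 1"
    using assms by (auto simp: coord_matrix_def B_def mat_def vec_eq_iff inj_eq)
  then have "det (coord_matrix \<kappa> B) \<noteq> 0" by simp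
  from nonzero_set_open_dense[OF real_polynomial_function_det_coord_matrix this]
  show "open {T :: real^'p^'n^'m. det (coord_matrix \<kappa> T) \<noteq> 0}"
    "closure {T :: real^'p^'n^'m. det (coord_matrix \<kappa> T) \<noteq> 0} = UNIV" by auto
  assume det: "det (coord_matrix \<kappa> T) \<noteq> 0"
  have "v = 0" if "contract T v = 0" for v
  proof -
    have "coord_matrix \<kappa> T *v v = 0" by (simp add: vec_eq_iff coord_matrix_mult that)
    then show ?thesis using det det_nonzero_iff_ker by blast
  qed
  then show "CARD('p) \<le> tensor_rank T" by (rule tensor_rank_ge_if_contract_inj)
qed

text \<open>Generically the slices span all matrices. With fewer than m n terms, all slices would
  lie in the hyperplane orthogonal to some nonzero M.\<close>

lemma generic_rank_ge_mn:
  assumes "CARD('m::finite) * CARD('n::finite) \<le> CARD('p::finite)"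
  obtains X :: "(real^'p^'n^'m) set" where "open X" "closure X = UNIV"
    "\<And>T. T \<in> X \<Longrightarrow> CARD('m) * CARD('n) \<le> tensor_rank T"
proof -
  obtain \<iota> :: "'m \<times> 'n \<Rightarrow> 'p" where \<iota>: "inj \<iota>"
    using card_le_inj[of "UNIV :: ('m \<times> 'n) set" "UNIV :: 'p set"] assms by auto
  define A :: "real^'p^'n^'m \<Rightarrow> real^('m \<times> 'n)^('m \<times> 'n)" where
    "A T = (\<chi> z' z. T $ fst z $ snd z $ \<iota> z')" for T
  define B :: "real^'p^'n^'m" where "B = (\<chi> i j l. of_bool (\<iota> (i, j) = l))"
  have "A B = mat 1" using \<iota> by (auto simp: A_def B_def mat_def vec_eq_iff inj_eq)
  then have "det (A B) \<noteq> 0" by simp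
  moreover have "real_polynomial_function (\<lambda>T. det (A T))"
    by (rule real_polynomial_function_det) (simp add: A_def real_polynomial_function_entry)
  ultimately have X: "open {T. det (A T) \<noteq> 0}" "closure {T. det (A T) \<noteq> 0} = UNIV"
    using nonzero_set_open_dense by blast+
  have "CARD('m) * CARD('n) \<le> tensor_rank T" if det: "det (A T) \<noteq> 0" for T
  proof (rule ccontr)
    assume less: "\<not> CARD('m) * CARD('n) \<le> tensor_rank T"
    obtain a b c where T: "T = (\<Sum>s<tensor_rank T. outer3 (a s) (b s) (c s))"
      by (rule tensor_rank_decomp)
    obtain M :: "real^'n^'m" where M: "M \<noteq> 0" "\<And>s. s < tensor_rank T \<Longrightarrow> inner (outer2 (a s) (b s)) M = 0"
      using exists_orthogonal_to_few[of "tensor_rank T" "\<lambda>s. outer2 (a s) (b s) :: real^'n^'m"] less by auto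
    have "(\<Sum>z\<in>UNIV. T $ fst z $ snd z $ l * M $ fst z $ snd z) = 0" for l
    proof -
      have "T $ i $ j $ l = (\<Sum>s<tensor_rank T. a s $ i * b s $ j * c s $ l)" for i j
        by (subst T) (simp add: outer3_def)
      then have "(\<Sum>z\<in>UNIV. T $ fst z $ snd z $ l * M $ fst z $ snd z)
        = (\<Sum>z\<in>UNIV. \<Sum>s<tensor_rank T. c s $ l * (a s $ fst z * b s $ snd z * M $ fst z $ snd z))"
        by (simp add: sum_distrib_left sum_distrib_right algebra_simps)
      also have "\<dots> = (\<Sum>s<tensor_rank T. c s $ l * (\<Sum>z\<in>UNIV. a s $ fst z * b s $ snd z * M $ fst z $ snd z))"
        by (subst sum.swap) (simp add: sum_distrib_left)
      also have "\<dots> = (\<Sum>s<tensor_rank T. c s $ l * inner (outer2 (a s) (b s)) M)"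
        by (simp add: inner_vec_def outer2_def sum.cartesian_product UNIV_Times_UNIV case_prod_beta)
      also have "\<dots> = 0" using M(2) by simp
      finally show ?thesis .
    qed
    then have "A T *v (\<chi> z. M $ fst z $ snd z) = 0"
      by (simp add: A_def matrix_vector_mult_def vec_eq_iff)
    then have "(\<chi> z. M $ fst z $ snd z) = 0" using det det_nonzero_iff_ker by blast
    then have "M $ i $ j = 0" for i j
    proof -
      have "(\<chi> z. M $ fst z $ snd z) $ (i, j) = 0"
        unfolding \<open>(\<chi> z. M $ fst z $ snd z) = 0\<close> by simp
      then show ?thesis by simp
    qed
    then show False using M(1) by (simp add: vec_eq_iff)
  qed
  with X that show ?thesis by blast
qed

text \<open>Projecting \<open>outer2 x y\<close> along the span of the slices gives a bilinear map
  to the m n - p entries outside \<open>\<kappa>\<close>; its nontrivial zeros are the rank-one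
  matrices in the span.\<close>

lemma rank_one_in_span_if_no_nonsingular:
  fixes T :: "real^'p^'n^'m"
  assumes \<kappa>: "inj \<kappa>" and det: "det (coord_matrix \<kappa> T) \<noteq> 0"
    and ns: "\<not> (\<exists>f :: real^'m \<Rightarrow> real^'n \<Rightarrow> nat \<Rightarrow> real. nonsingular_bilinear (CARD('m) * CARD('n) - CARD('p)) f)"
  obtains c x y where "contract T c = outer2 x y" "x \<noteq> 0" "y \<noteq> 0"
proof -
  let ?u = "CARD('m) * CARD('n) - CARD('p)"
  obtain R' where R': "coord_matrix \<kappa> T ** R' = mat 1"
    using det unfolding invertible_det_nz[symmetric] invertible_def by blast
  \<comment> \<open>Coefficients of the combination of slices that agrees with M at
    \<open>\<kappa>\<close>.\<close>
  define co :: "real^'n^'m \<Rightarrow> real^'p" where "co M = R' *v (\<chi> l. M $ fst (\<kappa> l) $ snd (\<kappa> l))" for M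
  define g where "g M = M - contract T (co M)" for M
  have "linear (\<lambda>M::real^'n^'m. (\<chi> l. M $ fst (\<kappa> l) $ snd (\<kappa> l)))"
    by (rule linearI) (simp_all add: vec_eq_iff)
  from linear_compose[OF this matrix_vector_mul_linear[of R']]
  have "linear co" by (simp add: co_def[abs_def] o_def)
  from linear_compose[OF this linear_contract[of T]]
  have lin_g: "linear g" unfolding g_def by (intro linear_compose_sub linear_ident) (simp add: o_def)
  have g\<kappa>: "g M $ fst (\<kappa> l) $ snd (\<kappa> l) = 0" for M l
  proof -
    have "contract T (co M) $ fst (\<kappa> l) $ snd (\<kappa> l) = (coord_matrix \<kappa> T *v co M) $ l"
      by (simp add: coord_matrix_mult)
    also have "\<dots> = M $ fst (\<kappa> l) $ snd (\<kappa> l)"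
      unfolding co_def matrix_vector_mul_assoc R' by simp
    finally show ?thesis by (simp add: g_def)
  qed
  have "card (- range \<kappa>) = ?u"
    using card_image[OF \<kappa>] by (simp add: Compl_eq_Diff_UNIV card_Diff_subset)
  then obtain h where h: "bij_betw h {..<?u} (- range \<kappa>)"
    using ex_bij_betw_nat_finite[of "- range \<kappa>"] by (auto simp: lessThan_atLeast0)
  define f where "f x y i = g (outer2 x y) $ fst (h i) $ snd (h i)" for x y i
  have lin_e: "linear (\<lambda>M. g M $ a $ b)" for a b
    using lin_g by (intro linearI) (simp_all add: linear_add linear_scale)
  have "bilinear (\<lambda>x y. f x y i)" for i
  proof -
    have "linear (\<lambda>y. outer2 x y)" "linear (\<lambda>x. outer2 x y)" for x :: "real^'m" and y :: "real^'n"
      using bilinear_outer2 unfolding bilinear_def by auto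
    from this[THEN linear_compose, OF lin_e[of "fst (h i)" "snd (h i)"]]
    show ?thesis unfolding bilinear_def f_def by (simp add: o_def)
  qed
  then obtain x y where xy: "\<forall>i<?u. f x y i = 0" "x \<noteq> 0" "y \<noteq> 0"
    using ns unfolding nonsingular_bilinear_def by blast
  have "g (outer2 x y) $ i $ j = 0" for i j
  proof (cases "(i, j) \<in> range \<kappa>")
    case True
    then show ?thesis using g\<kappa> by (metis fst_conv imageE snd_conv)
  next
    case False
    then have "(i, j) \<in> h ` {..<?u}" unfolding bij_betw_imp_surj_on[OF h] by simp
    then obtain s where "s < ?u" "h s = (i, j)" by force
    then show ?thesis using xy(1) by (auto simp: f_def)
  qed
  then have "g (outer2 x y) = 0" by (simp add: vec_eq_iff)
  then have "contract T (co (outer2 x y)) = outer2 x y" by (simp add: g_def)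
  with xy that show ?thesis by blast
qed

text \<open>Vanishing of the 2 x 2 minors, a form in which closedness is immediate.\<close>

definition rank_le_one :: "(real^'n^'m) set" where
  "rank_le_one = {M. \<forall>i j i' j'. M $ i $ j * M $ i' $ j' = M $ i $ j' * M $ i' $ j}"

lemma closed_rank_le_one: "closed (rank_le_one :: (real^'n^'m) set)"
proof -
  have "rank_le_one = (\<Inter>i. \<Inter>j. \<Inter>i'. \<Inter>j'. {M :: real^'n^'m. M $ i $ j * M $ i' $ j' = M $ i $ j' * M $ i' $ j})"
    by (auto simp: rank_le_one_def)
  also have "closed \<dots>" by (intro closed_INT ballI closed_Collect_eq continuous_intros)
  finally show ?thesis .
qed

lemma outer2_in_rank_le_one: "r *\<^sub>R outer2 x y \<in> rank_le_one"
  by (simp add: rank_le_one_def outer2_def)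

lemma zero_in_rank_le_one: "0 \<in> rank_le_one"
  by (simp add: rank_le_one_def)

lemma scale_in_rank_le_one: "M \<in> rank_le_one \<Longrightarrow> r *\<^sub>R M \<in> rank_le_one"
  by (simp add: rank_le_one_def algebra_simps)

lemma rank_le_one_imp_outer2:
  assumes "M \<in> rank_le_one"
  obtains x y where "M = outer2 x y"
proof (cases "M = 0")
  case True
  then have "M = outer2 0 0" by (simp add: outer2_def vec_eq_iff)
  then show ?thesis by (rule that)
next
  case False
  then obtain i' j' where nz: "M $ i' $ j' \<noteq> 0" by (auto simp: vec_eq_iff)
  have "M $ i $ j * M $ i' $ j' = M $ i $ j' * M $ i' $ j" for i j
    using assms by (simp add: rank_le_one_def)
  then have "M = outer2 (\<chi> i. M $ i $ j' / M $ i' $ j') (\<chi> j. M $ i' $ j)"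
    using nz by (simp add: outer2_def vec_eq_iff field_simps)
  then show ?thesis by (rule that)
qed

text \<open>Slices chosen in the common kernel of the u forms have no rank-one matrix in their span,
  and by compactness this persists nearby. Rank at most p would leave one: contract with a v that
  kills all terms but one.\<close>

lemma nonsingular_imp_rank_gt_open:
  fixes f :: "real^'m \<Rightarrow> real^'n \<Rightarrow> nat \<Rightarrow> real"
  assumes ns: "nonsingular_bilinear u f" and u: "CARD('m) * CARD('n) = CARD('p::finite) + u"
  obtains X :: "(real^'p^'n^'m) set" where "open X" "X \<noteq> {}" "\<And>T. T \<in> X \<Longrightarrow> Suc CARD('p) \<le> tensor_rank T"
proof -
  \<comment> \<open>Coordinate i of f as a linear form on matrices; the common kernel then has
    dimension at least m n - u = p.\<close>
  define F :: "nat \<Rightarrow> real^'n^'m" where "F i = (\<chi> a b. f (axis a 1) (axis b 1) i)" for i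
  have F: "f x y i = inner (F i) (outer2 x y)" if "i < u" for x y i
  proof -
    have bl: "bilinear (\<lambda>x y. f x y i)" using ns that by (simp add: nonsingular_bilinear_def)
    have "f x y i = f (\<Sum>a\<in>UNIV. x $ a *\<^sub>R axis a 1) (\<Sum>b\<in>UNIV. y $ b *\<^sub>R axis b 1) i"
      using basis_expansion[of x] basis_expansion[of y] by (simp add: scalar_mult_eq_scaleR)
    also have "\<dots> = (\<Sum>(a, b)\<in>UNIV \<times> UNIV. f (x $ a *\<^sub>R axis a 1) (y $ b *\<^sub>R axis b 1) i)"
      by (rule bilinear_sum[OF bl])
    also have "\<dots> = (\<Sum>(a, b)\<in>UNIV \<times> UNIV. x $ a * y $ b * f (axis a 1) (axis b 1) i)"
      using bilinear_lmul[OF bl] bilinear_rmul[OF bl] by (intro sum.cong) auto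
    also have "\<dots> = inner (F i) (outer2 x y)"
      by (simp add: inner_vec_def F_def outer2_def sum.cartesian_product algebra_simps)
    finally show ?thesis .
  qed
  define V where "V = {M. \<forall>i<u. inner (F i) M = 0}"
  have subV: "subspace V"
    by (auto simp: V_def subspace_def inner_add_right)
  have "dim {y \<in> UNIV. \<forall>x\<in>span (F ` {..<u}). orthogonal x y} + dim (span (F ` {..<u})) = dim (UNIV :: (real^'n^'m) set)"
    by (rule dim_subspace_orthogonal_to_vectors) auto
  moreover have "dim (span (F ` {..<u})) \<le> u"
  proof -
    have "dim (F ` {..<u}) \<le> card (F ` {..<u})" by (rule dim_le_card') simp
    also have "\<dots> \<le> u" using card_image_le[of "{..<u}" F] by simp
    finally show ?thesis by simp
  qed
  moreover have "dim {y \<in> UNIV. \<forall>x\<in>span (F ` {..<u}). orthogonal x y} \<le> dim V"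
    by (rule dim_subset) (auto simp: V_def orthogonal_def span_base)
  ultimately have dimV: "CARD('p) \<le> dim V" using u by simp
  obtain B where B: "B \<subseteq> V" "independent B" "card B = dim V"
    using basis_exists[of V] by metis
  have finB: "finite B" using B(2) independent_imp_finite by blast
  obtain g where g: "g ` (UNIV :: 'p set) \<subseteq> B" "inj g"
    using card_le_inj[of "UNIV :: 'p set" B] finB dimV B(3) by auto
  define T :: "real^'p^'n^'m" where "T = (\<chi> i j l. g l $ i $ j)"
  have Tv: "contract T v = (\<Sum>l\<in>UNIV. v $ l *\<^sub>R g l)" for v
    by (simp add: contract_def T_def vec_eq_iff mult.commute)
  have TV: "contract T v \<in> V" for v
    unfolding Tv using subV g(1) B(1) by (intro subspace_sum subspace_scale) auto
  have Tinj: "v = 0" if "contract T v = 0" for v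
  proof -
    have "(\<Sum>b\<in>range g. v $ inv g b *\<^sub>R b) = 0"
      using that unfolding Tv by (subst sum.reindex[OF g(2)]) (simp add: g(2) o_def)
    then have "v $ inv g b = 0" if "b \<in> range g" for b
      using independentD[OF B(2) _ g(1), of "\<lambda>b. v $ inv g b" b] that by auto
    then have "v $ l = 0" for l using g(2) by (metis inv_f_f rangeI)
    then show ?thesis by (simp add: vec_eq_iff)
  qed
  define K where "K = contract T ` sphere 0 1"
  have "compact K" unfolding K_def
    by (intro compact_continuous_image linear_continuous_on linear_conv_bounded_linear[THEN iffD1] linear_contract)
       simp
  moreover have "K \<inter> rank_le_one = {}"
  proof (rule ccontr)
    assume "K \<inter> rank_le_one \<noteq> {}"
    then obtain v where v: "norm v = 1" "contract T v \<in> rank_le_one" by (auto simp: K_def)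
    then obtain x y where xy: "contract T v = outer2 x y" using rank_le_one_imp_outer2 by blast
    then have "\<forall>i<u. f x y i = 0" using TV[of v] F by (simp add: V_def)
    then have "x = 0 \<or> y = 0" using ns unfolding nonsingular_bilinear_def by blast
    then have "contract T v = 0" unfolding xy by (auto simp: outer2_def vec_eq_iff)
    then have "v = 0" by (rule Tinj)
    then show False using v(1) by simp
  qed
  ultimately obtain \<delta> where \<delta>: "\<delta> > 0" "\<And>M M'. M \<in> K \<Longrightarrow> M' \<in> rank_le_one \<Longrightarrow> \<delta> \<le> dist M M'"
    using separate_compact_closed[OF _ closed_rank_le_one] by metis
  have "bilinear (contract :: real^'p^'n^'m \<Rightarrow> _)"
    unfolding bilinear_def
    by (intro conjI allI linear_contract)
       (auto intro!: linearI simp: contract_def vec_eq_iff algebra_simps sum.distrib sum_distrib_left)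
  then obtain C where C: "C > 0" "\<And>(T::real^'p^'n^'m) v. norm (contract T v) \<le> C * norm T * norm v"
    using bilinear_bounded_pos by blast
  \<comment> \<open>By homogeneity unit vectors suffice, and there a perturbation of norm below
    \<open>\<delta> / C\<close> moves the contraction by less than \<open>\<delta>\<close>.\<close>
  have far: "contract T' v \<notin> rank_le_one" if T': "T' \<in> ball T (\<delta> / C)" and v: "v \<noteq> 0" for T' v
  proof
    assume "contract T' v \<in> rank_le_one"
    define w where "w = (1 / norm v) *\<^sub>R v"
    have w: "norm w = 1" using v by (simp add: w_def)
    have "contract T' w \<in> rank_le_one"
      unfolding w_def linear_scale[OF linear_contract]
      by (rule scale_in_rank_le_one) fact
    then have "\<delta> \<le> dist (contract T w) (contract T' w)"
      using \<delta>(2) w by (auto simp: K_def)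
    also have "\<dots> = norm (contract (T - T') w)"
    proof -
      have "contract T w - contract T' w = contract (T - T') w"
        by (simp add: contract_def vec_eq_iff algebra_simps sum_subtractf)
      then show ?thesis by (simp add: dist_norm)
    qed
    also have "\<dots> \<le> C * norm (T - T') * norm w" by (rule C)
    also have "\<dots> < \<delta>" using T' C(1) w by (simp add: dist_norm field_simps)
    finally show False by simp
  qed
  have "Suc CARD('p) \<le> tensor_rank T'" if T': "T' \<in> ball T (\<delta> / C)" for T'
  proof (rule ccontr)
    assume less: "\<not> Suc CARD('p) \<le> tensor_rank T'"
    obtain a b c where T'': "T' = (\<Sum>s<tensor_rank T'. outer3 (a s) (b s) (c s))"
      by (rule tensor_rank_decomp)
    \<comment> \<open>One term is left alive, so even p terms are excluded; for rank 0 the truncated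
      difference is harmless.\<close>
    have "tensor_rank T' - 1 < CARD('p)" using less zero_less_card_finite[where ?'a = 'p] by linarith
    then obtain v where v: "v \<noteq> 0" "\<And>s. s < tensor_rank T' - 1 \<Longrightarrow> inner (c s) v = 0"
      using exists_orthogonal_to_few[of "tensor_rank T' - 1" c] by auto
    have eq: "contract T' v = (\<Sum>s<tensor_rank T'. inner (c s) v *\<^sub>R outer2 (a s) (b s))"
      by (subst T'') (rule contract_sum_outer3)
    have "contract T' v \<in> rank_le_one"
    proof (cases "tensor_rank T'")
      case 0
      then show ?thesis using eq zero_in_rank_le_one by simp
    next
      case (Suc r)
      then have "contract T' v = inner (c r) v *\<^sub>R outer2 (a r) (b r)"
        unfolding eq using v(2) by simp
      then show ?thesis using outer2_in_rank_le_one by metis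
    qed
    then show False using far[OF T' v(1)] by blast
  qed
  moreover have "T \<in> ball T (\<delta> / C)" using \<delta>(1) C(1) by simp
  ultimately show ?thesis by (intro that[of "ball T (\<delta> / C)"]) blast+
qed

text \<open>All m n products of coordinates form a nonsingular map, so the minimum is
  attained.\<close>

lemma hash_number_nonsingular:
  obtains f :: "real^'m \<Rightarrow> real^'n \<Rightarrow> nat \<Rightarrow> real"
    where "nonsingular_bilinear (hash_number TYPE('m) TYPE('n)) f"
proof -
  obtain h where h: "bij_betw h {..<card (UNIV :: ('m \<times> 'n) set)} (UNIV :: ('m \<times> 'n) set)"
    using ex_bij_betw_nat_finite[of "UNIV :: ('m \<times> 'n) set"] by (auto simp: lessThan_atLeast0)
  define f :: "real^'m \<Rightarrow> real^'n \<Rightarrow> nat \<Rightarrow> real" where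
    "f x y i = x $ fst (h i) * y $ snd (h i)" for x y i
  have "nonsingular_bilinear (card (UNIV :: ('m \<times> 'n) set)) f"
    unfolding nonsingular_bilinear_def
  proof (intro conjI allI impI)
    show "bilinear (\<lambda>x y. f x y i)" for i
      unfolding bilinear_def f_def by (auto intro!: linearI simp: algebra_simps)
    fix x y assume 0: "\<forall>i<card (UNIV :: ('m \<times> 'n) set). f x y i = 0"
    have "x $ a * y $ b = 0" for a b
    proof -
      have "(a, b) \<in> h ` {..<card (UNIV :: ('m \<times> 'n) set)}"
        unfolding bij_betw_imp_surj_on[OF h] by simp
      then obtain i where "i < card (UNIV :: ('m \<times> 'n) set)" "h i = (a, b)" by force
      then show ?thesis using 0 by (auto simp: f_def)
    qed
    then show "x = 0 \<or> y = 0" by (auto simp: vec_eq_iff)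
  qed
  then have "\<exists>f :: real^'m \<Rightarrow> real^'n \<Rightarrow> nat \<Rightarrow> real. nonsingular_bilinear (card (UNIV :: ('m \<times> 'n) set)) f" by blast
  then have "\<exists>f :: real^'m \<Rightarrow> real^'n \<Rightarrow> nat \<Rightarrow> real. nonsingular_bilinear (hash_number TYPE('m) TYPE('n)) f"
    unfolding hash_number_def by (rule LeastI)
  with that show ?thesis by blast
qed

lemma nonsingular_bilinear_mono:
  assumes "nonsingular_bilinear l f" "l \<le> u"
  shows "nonsingular_bilinear u (\<lambda>x y i. if i < l then f x y i else 0)"
proof -
  have "bilinear (\<lambda>x y. 0 :: real)" by (auto simp: bilinear_def intro!: linearI)
  then have "bilinear (\<lambda>x y. if i < l then f x y i else 0)" for i
    using assms(1) by (cases "i < l") (auto simp: nonsingular_bilinear_def)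
  then show ?thesis using assms unfolding nonsingular_bilinear_def by (metis order_less_le_trans)
qed

section \<open>Typical ranks from generic bounds\<close>

lemma open_dense_Int_nonempty:
  assumes "open U" "U \<noteq> {}" "closure D = UNIV"
  shows "U \<inter> D \<noteq> {}"
  using assms open_Int_closure_eq_empty[of U D] by auto

lemma trankI:
  fixes U V :: "(real^'p^'n^'m) set"
  assumes "open U" "open V" "U \<inter> V \<noteq> {}"
    and "\<And>T. T \<in> U \<Longrightarrow> r \<le> tensor_rank T" and "\<And>T. T \<in> V \<Longrightarrow> tensor_rank T \<le> r"
  shows "r \<in> trank TYPE('m) TYPE('n) TYPE('p)"
  unfolding trank_def using assms
  by (intro CollectI exI[of _ "U \<inter> V"]) (auto intro: antisym)

lemma trank_ge:
  fixes D :: "(real^'p^'n^'m) set"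
  assumes "r \<in> trank TYPE('m) TYPE('n) TYPE('p)" and "closure D = UNIV"
    and "\<And>T. T \<in> D \<Longrightarrow> s \<le> tensor_rank T"
  shows "s \<le> r"
proof -
  obtain U :: "(real^'p^'n^'m) set" where U: "open U" "U \<noteq> {}" "U \<subseteq> {T. tensor_rank T = r}"
    using assms(1) by (auto simp: trank_def)
  obtain T where "T \<in> U" "T \<in> D" using open_dense_Int_nonempty[OF U(1,2) assms(2)] by blast
  then show ?thesis using assms(3)[of T] U(3) by auto
qed

lemma trank_le:
  assumes "r \<in> trank TYPE('m) TYPE('n) TYPE('p)"
    and "closure (interior {T :: real^'p^'n^'m. tensor_rank T \<le> s}) = UNIV"
  shows "r \<le> s"
proof -
  obtain U :: "(real^'p^'n^'m) set" where U: "open U" "U \<noteq> {}" "U \<subseteq> {T. tensor_rank T = r}"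
    using assms(1) by (auto simp: trank_def)
  obtain T where T: "T \<in> U" "T \<in> interior {T. tensor_rank T \<le> s}"
    using open_dense_Int_nonempty[OF U(1,2) assms(2)] by blast
  then have "tensor_rank T \<le> s" using interior_subset by blast
  then show ?thesis using T(1) U(3) by auto
qed

lemma trank_eq_mn:
  assumes "CARD('m::finite) * CARD('n::finite) \<le> CARD('p::finite)"
  shows "trank TYPE('m) TYPE('n) TYPE('p) = {CARD('m) * CARD('n)}"
proof -
  obtain X :: "(real^'p^'n^'m) set" where X: "open X" "closure X = UNIV"
    "\<And>T. T \<in> X \<Longrightarrow> CARD('m) * CARD('n) \<le> tensor_rank T"
    using generic_rank_ge_mn[OF assms] by blast
  have "X \<noteq> {}" using X(2) by auto
  then have "CARD('m) * CARD('n) \<in> trank TYPE('m) TYPE('n) TYPE('p)"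
    by (intro trankI[OF X(1) open_UNIV]) (use X(3) tensor_rank_le_mn in auto)
  moreover have "r = CARD('m) * CARD('n)" if r: "r \<in> trank TYPE('m) TYPE('n) TYPE('p)" for r
    using trank_ge[OF r X(2,3)] trank_le[OF r, of "CARD('m) * CARD('n)"]
    by (simp add: tensor_rank_le_mn)
  ultimately show ?thesis by blast
qed

theorem theorem1p2:
  fixes m n p k :: nat
  assumes "m = CARD('m::finite)" and "n = CARD('n::finite)" and "p = CARD('p::finite)"
    and "m \<ge> 3" and "n \<ge> 3" and "k \<ge> 2"
    and "p = (m - 1) * (n - 1) + k"
  shows
    "(2 \<le> k \<and> int k \<le> int m + int n - 1 - int (hash_number TYPE('m) TYPE('n))
        \<longrightarrow> trank TYPE('m) TYPE('n) TYPE('p) = {p, p + 1}) \<and>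
     (max 2 (int m + int n - int (hash_number TYPE('m) TYPE('n))) \<le> int k \<and> k \<le> m + n - 2
        \<longrightarrow> trank TYPE('m) TYPE('n) TYPE('p) = {p}) \<and>
     (k \<ge> m + n - 1
        \<longrightarrow> trank TYPE('m) TYPE('n) TYPE('p) = {m * n})"
proof -
  let ?h = "hash_number TYPE('m) TYPE('n)"
  let ?t = "trank TYPE('m) TYPE('n) TYPE('p)"
  let ?S = "\<lambda>r. interior {T :: real^'p^'n^'m. tensor_rank T \<le> r}"
  \<comment> \<open>Gives m n - p = m + n - 1 - k, the dimension to be compared with m # n.\<close>
  have mn: "m * n + 1 = (m - 1) * (n - 1) + m + n"
    using assms(4,5) by (cases m; cases n) auto
  have big: "?t = {m * n}" if "k \<ge> m + n - 1"
    using trank_eq_mn[where ?'m = 'm and ?'n = 'n and ?'p = 'p] mn assms that by simp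
  have small: "p \<in> ?t" "r \<in> ?t \<Longrightarrow> p \<le> r"
    "(\<nexists>f :: real^'m \<Rightarrow> real^'n \<Rightarrow> nat \<Rightarrow> real. nonsingular_bilinear (m + n - 1 - k) f) \<Longrightarrow> closure (?S p) = UNIV"
    "closure (?S (p + 1)) = UNIV" if k: "k < m + n - 1" for r
  proof -
    have pmn: "m * n = p + (m + n - 1 - k)" using mn k assms by simp
    have lt: "p < m * n" using pmn k by simp
    have sizes: "CARD('m) \<ge> 2" "CARD('n) \<ge> 2" "(CARD('m) - 1) * (CARD('n) - 1) + 2 \<le> CARD('p)"
      "CARD('p) \<le> CARD('m) * CARD('n)" "CARD('p) < CARD('m) * CARD('n)"
      using assms lt by auto
    obtain \<kappa> :: "'p \<Rightarrow> 'm \<times> 'n" where \<kappa>: "inj \<kappa>"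
      using card_le_inj[of "UNIV :: 'p set" "UNIV :: ('m \<times> 'n) set"] sizes by auto
    note dense = generic_rank_ge_third_dim[OF \<kappa>]
    have gen: "T \<in> closure (?S p)" if "contract T c = outer2 x y" "x \<noteq> 0" "y \<noteq> 0" for T c x y
      using closure_interior_rank_if_rank_one[OF sizes(1-4) that] assms(3) by simp
    show "p \<le> r" if r: "r \<in> ?t"
      by (rule trank_ge[OF r dense(2)]) (use dense(3) assms(3) in auto)
    \<comment> \<open>A single tensor with a rank-one matrix in its slice span shows that the
      interior is nonempty.\<close>
    have "\<exists>T :: real^'p^'n^'m. T \<in> closure (?S p)"
    proof -
      let ?x = "axis undefined 1 :: real^'m" and ?y = "axis undefined 1 :: real^'n"
      let ?c = "axis undefined 1 :: real^'p"
      have "contract (outer3 ?x ?y ?c) ?c = outer2 ?x ?y"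
        using contract_sum_outer3[of "\<lambda>_. ?x" "\<lambda>_. ?y" "\<lambda>_. ?c" "{0::nat}" ?c] by (simp add: inner_axis_axis)
      then show ?thesis using gen by (metis axis_eq_0_iff zero_neq_one)
    qed
    then have "?S p \<noteq> {}" by auto
    then have "{T. det (coord_matrix \<kappa> T) \<noteq> 0} \<inter> ?S p \<noteq> {}"
      using open_dense_Int_nonempty[OF open_interior _ dense(2)] by blast
    then show "p \<in> ?t"
      by (rule trankI[OF dense(1) open_interior])
         (use dense(3) interior_subset assms(3) in blast)+
    show "closure (?S (p + 1)) = UNIV"
      using closure_interior_rank_le_Suc[where ?'p = 'p and ?'m = 'm and ?'n = 'n] sizes assms(3) by auto
    assume ns: "\<nexists>f :: real^'m \<Rightarrow> real^'n \<Rightarrow> nat \<Rightarrow> real. nonsingular_bilinear (m + n - 1 - k) f"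
    have "m + n - 1 - k = CARD('m) * CARD('n) - CARD('p)" using pmn assms by simp
    with ns have ns': "\<nexists>f :: real^'m \<Rightarrow> real^'n \<Rightarrow> nat \<Rightarrow> real.
        nonsingular_bilinear (CARD('m) * CARD('n) - CARD('p)) f" by simp
    have "T \<in> closure (?S p)" if "det (coord_matrix \<kappa> T) \<noteq> 0" for T
      by (rule rank_one_in_span_if_no_nonsingular[OF \<kappa> that ns']) (rule gen)
    then have "{T :: real^'p^'n^'m. det (coord_matrix \<kappa> T) \<noteq> 0} \<subseteq> closure (?S p)" by blast
    then show "closure (?S p) = UNIV"
      using dense(2) closure_minimal[OF _ closed_closure] by blast
  qed
  have one: "?t = {p, p + 1}" if "int k \<le> int m + int n - 1 - int ?h"
  proof -
    obtain f :: "real^'m \<Rightarrow> real^'n \<Rightarrow> nat \<Rightarrow> real" where f: "nonsingular_bilinear ?h f"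
      by (rule hash_number_nonsingular)
    \<comment> \<open>Positivity turns the bound on k into \<open>k < m + n - 1\<close>, so the
      natural subtraction below is exact.\<close>
    have "?h \<noteq> 0"
    proof
      assume "?h = 0"
      then have "nonsingular_bilinear 0 f" using f by simp
      then have "(axis undefined 1 :: real^'m) = 0 \<or> (axis undefined 1 :: real^'n) = 0"
        unfolding nonsingular_bilinear_def by blast
      then show False by (simp add: axis_eq_0_iff)
    qed
    then have k: "k < m + n - 1" and hk: "?h \<le> m + n - 1 - k" using that by linarith+
    have "CARD('m) * CARD('n) = CARD('p) + (m + n - 1 - k)" using mn k assms by simp
    then obtain X :: "(real^'p^'n^'m) set"
      where X: "open X" "X \<noteq> {}" "\<And>T. T \<in> X \<Longrightarrow> Suc CARD('p) \<le> tensor_rank T"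
      using nonsingular_imp_rank_gt_open[OF nonsingular_bilinear_mono[OF f hk]] by blast
    \<comment> \<open>Rank at least p + 1 on an open set meets generic rank at most p + 1, so p + 1
      is typical.\<close>
    have "X \<inter> closure (?S (p + 1)) \<noteq> {}" using X(2) small(4)[OF k] by auto
    then have "X \<inter> ?S (p + 1) \<noteq> {}" using open_Int_closure_eq_empty[OF X(1)] by blast
    moreover have "p + 1 \<le> tensor_rank T" if "T \<in> X" for T using X(3)[OF that] assms(3) by simp
    moreover have "tensor_rank T \<le> p + 1" if "T \<in> ?S (p + 1)" for T
      using that interior_subset by blast
    ultimately have "p + 1 \<in> ?t" by (rule trankI[OF X(1) open_interior])
    moreover have "r \<in> {p, p + 1}" if r: "r \<in> ?t" for r
      using small(2)[OF k r] trank_le[OF r small(4)[OF k]] by auto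
    ultimately show ?thesis using small(1)[OF k] by blast
  qed
  have two: "?t = {p}" if "int m + int n - int ?h \<le> int k" "k \<le> m + n - 2"
  proof -
    have k: "k < m + n - 1" using that assms by linarith
    have "m + n - 1 - k < ?h" using that k by linarith
    then have "\<nexists>f :: real^'m \<Rightarrow> real^'n \<Rightarrow> nat \<Rightarrow> real. nonsingular_bilinear (m + n - 1 - k) f"
      unfolding hash_number_def by (rule not_less_Least)
    then have "r = p" if r: "r \<in> ?t" for r
      using small(2)[OF k r] trank_le[OF r small(3)[OF k]] by auto
    then show ?thesis using small(1)[OF k] by blast
  qed
  show ?thesis using one two big by auto
qed

end
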